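(* Let $\mathcal X$ and $\mathcal Y$ be infinite dimensional complex Banach spaces, let $A\in L(\mathcal X)$ and $B\in L(\mathcal Y)$, and let $\rho\colon L(\mathcal Y,\mathcal X)\to L(\mathcal Y,\mathcal X)$ be the generalized derivation defined by $A$ and $B$, i.e. $\rho(U)=AU-UB$ for $U\in L(\mathcal Y,\mathcal X)$. If $A$ and $B^*$ are isoloid, then $\rho\in L(L(\mathcal Y,\mathcal X))$ is isoloid. Likewise, if $A$ and $B^*$ are $a$-isoloid, then $\rho$ is $a$-isoloid.
   Context: $L(\mathcal Y,\mathcal X)$ is the Banach space of bounded linear maps from $\mathcal Y$ to $\mathcal X$, $L(\mathcal X)=L(\mathcal X,\mathcal X)$, and $B^*\in L(\mathcal Y^* )$ is the (Banach space) adjoint of $B$. For $K\subseteq\mathbb C$, $\mathrm{iso}\,K$ is the set of isolated points of $K$. For a bounded operator $T$ on a Banach space, $\sigma(T)$ is the spectrum, $\alpha(T)=\dim N(T)$ is the dimension of the null space, and $\sigma_a(T)$ is the set of $\lambda\in\mathbb C$ such that $T-\lambda$ is not bounded below (bounded below: injective with closed range). $E(T)=\{\lambda\in\mathrm{iso}\,\sigma(T):0<\alpha(T-\lambda)\}$ and $E^a(T)=\{\lambda\in\mathrm{iso}\,\sigma_a(T):0<\alpha(T-\lambda)\}$. $T$ is isoloid if $\mathrm{iso}\,\sigma(T)=E(T)$, and $a$-isoloid if $\mathrm{iso}\,\sigma_a(T)=E^a(T)$. *)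

theory Defs
  imports "HOL-Analysis.Analysis"
begin

section \<open>Complex normed spaces\<close>

text \<open>The library has real normed spaces only. A complex one is a real normed space together with a
  complex scalar multiplication that extends the real one and is compatible with the norm.\<close>

class complex_normed_vector = real_normed_vector +
  fixes scaleC :: "complex \<Rightarrow> 'a \<Rightarrow> 'a" (infixr "*\<^sub>C" 75)
  assumes scaleC_add_right: "c *\<^sub>C (x + y) = c *\<^sub>C x + c *\<^sub>C y"
    and scaleC_add_left: "(c + d) *\<^sub>C x = c *\<^sub>C x + d *\<^sub>C x"
    and scaleC_scaleC: "c *\<^sub>C (d *\<^sub>C x) = (c * d) *\<^sub>C x"
    and scaleC_of_real: "complex_of_real r *\<^sub>C x = r *\<^sub>R x"
    and norm_scaleC: "norm (c *\<^sub>C x) = cmod c * norm x"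

class complex_banach = complex_normed_vector + banach

lemma scaleC_one [simp]: "1 *\<^sub>C (x :: 'a::complex_normed_vector) = x"
  using scaleC_of_real[of 1 x] by simp

global_interpretation complex_vector:
  vector_space "scaleC :: complex \<Rightarrow> 'a \<Rightarrow> 'a::complex_normed_vector"
  by unfold_locales (simp_all add: scaleC_add_right scaleC_add_left scaleC_scaleC)

instantiation complex :: complex_banach
begin

definition scaleC_complex :: "complex \<Rightarrow> complex \<Rightarrow> complex"
  where "scaleC_complex c x = c * x"

instance
  by standard (simp_all add: scaleC_complex_def algebra_simps norm_mult scaleR_conv_of_real)

end

definition finite_dimensional :: "'a::complex_normed_vector set \<Rightarrow> bool"
  where "finite_dimensional S \<longleftrightarrow> (\<exists>B. finite B \<and> S \<subseteq> complex_vector.span B)"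

text \<open>The library's dimension is a natural number, with a junk value for spaces that are not finite
  dimensional, hence the case distinction.\<close>

definition cdimension :: "'a::complex_normed_vector set \<Rightarrow> enat"
  where "cdimension S = (if finite_dimensional S then enat (complex_vector.dim S) else \<infinity>)"


section \<open>The Banach space of bounded complex linear maps\<close>

definition bounded_clinear :: "('a::complex_normed_vector \<Rightarrow> 'b::complex_normed_vector) \<Rightarrow> bool"
  where "bounded_clinear f \<longleftrightarrow> bounded_linear f \<and> (\<forall>c x. f (c *\<^sub>C x) = c *\<^sub>C f x)"

lemma bounded_clinearD:
  assumes "bounded_clinear f"
  shows "bounded_linear f" "f (c *\<^sub>C x) = c *\<^sub>C f x"
  using assms by (auto simp: bounded_clinear_def)

lemma bounded_linear_scaleC: "bounded_linear (\<lambda>x. c *\<^sub>C (x :: 'a::complex_normed_vector))"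
proof (rule bounded_linear_intro[where K = "cmod c"])
  fix r and x :: 'a
  show "c *\<^sub>C (r *\<^sub>R x) = r *\<^sub>R (c *\<^sub>C x)"
    by (simp flip: scaleC_of_real add: scaleC_scaleC mult.commute)
qed (simp_all add: scaleC_add_right norm_scaleC mult.commute)

lemma bounded_clinear_zero: "bounded_clinear (\<lambda>_. 0)"
  by (simp add: bounded_clinear_def)

lemma bounded_clinear_ident: "bounded_clinear (\<lambda>x. x)"
  by (simp add: bounded_clinear_def bounded_linear_ident)

lemma bounded_clinear_add:
  "bounded_clinear f \<Longrightarrow> bounded_clinear g \<Longrightarrow> bounded_clinear (\<lambda>x. f x + g x)"
  by (simp add: bounded_clinear_def bounded_linear_add scaleC_add_right)

lemma bounded_clinear_minus: "bounded_clinear f \<Longrightarrow> bounded_clinear (\<lambda>x. - f x)"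
  by (simp add: bounded_clinear_def bounded_linear_minus)

lemma bounded_clinear_diff:
  "bounded_clinear f \<Longrightarrow> bounded_clinear g \<Longrightarrow> bounded_clinear (\<lambda>x. f x - g x)"
  using bounded_clinear_add[of f "\<lambda>x. - g x"] bounded_clinear_minus[of g] by simp

lemma bounded_clinear_scaleC: "bounded_clinear f \<Longrightarrow> bounded_clinear (\<lambda>x. c *\<^sub>C f x)"
  by (auto simp: bounded_clinear_def scaleC_scaleC mult.commute
      intro: bounded_linear_compose[OF bounded_linear_scaleC])

lemma bounded_clinear_scaleR: "bounded_clinear f \<Longrightarrow> bounded_clinear (\<lambda>x. r *\<^sub>R f x)"
  using bounded_clinear_scaleC[of f "complex_of_real r"] by (simp add: scaleC_of_real)

lemma bounded_clinear_compose:
  "bounded_clinear f \<Longrightarrow> bounded_clinear g \<Longrightarrow> bounded_clinear (\<lambda>x. f (g x))"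
  by (simp add: bounded_clinear_def bounded_linear_compose)

typedef (overloaded) ('a, 'b) cblinfun ("(_ \<Rightarrow>\<^sub>C\<^sub>L /_)" [22, 21] 21) =
  "{f :: 'a::complex_normed_vector \<Rightarrow> 'b::complex_normed_vector. bounded_clinear f}"
  morphisms cblinfun_apply CBlinfun
  using bounded_clinear_zero by blast

notation cblinfun_apply (infixr "*\<^sub>V" 70)

setup_lifting type_definition_cblinfun

lemma cblinfun_eqI: "(\<And>x. F *\<^sub>V x = G *\<^sub>V x) \<Longrightarrow> F = G"
  by transfer auto

instantiation cblinfun :: (complex_normed_vector, complex_normed_vector) complex_normed_vector
begin

lift_definition zero_cblinfun :: "'a \<Rightarrow>\<^sub>C\<^sub>L 'b" is "\<lambda>_. 0"
  by (rule bounded_clinear_zero)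

lift_definition plus_cblinfun :: "('a \<Rightarrow>\<^sub>C\<^sub>L 'b) \<Rightarrow> ('a \<Rightarrow>\<^sub>C\<^sub>L 'b) \<Rightarrow> ('a \<Rightarrow>\<^sub>C\<^sub>L 'b)"
  is "\<lambda>f g x. f x + g x" by (rule bounded_clinear_add)

lift_definition uminus_cblinfun :: "('a \<Rightarrow>\<^sub>C\<^sub>L 'b) \<Rightarrow> ('a \<Rightarrow>\<^sub>C\<^sub>L 'b)"
  is "\<lambda>f x. - f x" by (rule bounded_clinear_minus)

lift_definition minus_cblinfun :: "('a \<Rightarrow>\<^sub>C\<^sub>L 'b) \<Rightarrow> ('a \<Rightarrow>\<^sub>C\<^sub>L 'b) \<Rightarrow> ('a \<Rightarrow>\<^sub>C\<^sub>L 'b)"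
  is "\<lambda>f g x. f x - g x" by (rule bounded_clinear_diff)

lift_definition scaleR_cblinfun :: "real \<Rightarrow> ('a \<Rightarrow>\<^sub>C\<^sub>L 'b) \<Rightarrow> ('a \<Rightarrow>\<^sub>C\<^sub>L 'b)"
  is "\<lambda>r f x. r *\<^sub>R f x" by (rule bounded_clinear_scaleR)

lift_definition scaleC_cblinfun :: "complex \<Rightarrow> ('a \<Rightarrow>\<^sub>C\<^sub>L 'b) \<Rightarrow> ('a \<Rightarrow>\<^sub>C\<^sub>L 'b)"
  is "\<lambda>c f x. c *\<^sub>C f x" by (rule bounded_clinear_scaleC)

lift_definition norm_cblinfun :: "('a \<Rightarrow>\<^sub>C\<^sub>L 'b) \<Rightarrow> real" is onorm .

definition dist_cblinfun :: "('a \<Rightarrow>\<^sub>C\<^sub>L 'b) \<Rightarrow> ('a \<Rightarrow>\<^sub>C\<^sub>L 'b) \<Rightarrow> real"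
  where "dist_cblinfun F G = norm (F - G)"

definition sgn_cblinfun :: "('a \<Rightarrow>\<^sub>C\<^sub>L 'b) \<Rightarrow> ('a \<Rightarrow>\<^sub>C\<^sub>L 'b)"
  where "sgn_cblinfun F = inverse (norm F) *\<^sub>R F"

definition uniformity_cblinfun :: "(('a \<Rightarrow>\<^sub>C\<^sub>L 'b) \<times> ('a \<Rightarrow>\<^sub>C\<^sub>L 'b)) filter"
  where [code del]: "uniformity_cblinfun = (INF e\<in>{0 <..}. principal {(F, G). dist F G < e})"

definition open_cblinfun :: "('a \<Rightarrow>\<^sub>C\<^sub>L 'b) set \<Rightarrow> bool"
  where [code del]:
    "open_cblinfun S = (\<forall>F\<in>S. \<forall>\<^sub>F (F', G) in uniformity. F' = F \<longrightarrow> G \<in> S)"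

instance
proof
  fix F G H :: "'a \<Rightarrow>\<^sub>C\<^sub>L 'b" and r s :: real and c d :: complex
  show "F + G + H = F + (G + H)" "F + G = G + F" "0 + F = F" "- F + F = 0" "F - G = F + - G"
    by (transfer, simp add: algebra_simps)+
  show "r *\<^sub>R (F + G) = r *\<^sub>R F + r *\<^sub>R G" "(r + s) *\<^sub>R F = r *\<^sub>R F + s *\<^sub>R F"
    "r *\<^sub>R s *\<^sub>R F = (r * s) *\<^sub>R F" "1 *\<^sub>R F = F"
    by (transfer, simp add: algebra_simps)+
  show "c *\<^sub>C (F + G) = c *\<^sub>C F + c *\<^sub>C G" "(c + d) *\<^sub>C F = c *\<^sub>C F + d *\<^sub>C F"
    "c *\<^sub>C d *\<^sub>C F = (c * d) *\<^sub>C F" "complex_of_real r *\<^sub>C F = r *\<^sub>R F"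
    by (transfer, simp add: scaleC_add_right scaleC_add_left scaleC_scaleC scaleC_of_real)+
  show "dist F G = norm (F - G)"
    by (rule dist_cblinfun_def)
  show "sgn F = inverse (norm F) *\<^sub>R F"
    by (rule sgn_cblinfun_def)
  show "uniformity = (INF e\<in>{0 <..}. principal {(F :: 'a \<Rightarrow>\<^sub>C\<^sub>L 'b, G). dist F G < e})"
    by (rule uniformity_cblinfun_def)
  show "open S = (\<forall>F\<in>S. \<forall>\<^sub>F (F', G) in uniformity. F' = F \<longrightarrow> G \<in> S)"
    for S :: "('a \<Rightarrow>\<^sub>C\<^sub>L 'b) set"
    by (rule open_cblinfun_def)
  show "(norm F = 0) = (F = 0)"
    by transfer (auto simp: onorm_eq_0 fun_eq_iff dest: bounded_clinearD)
  show "norm (F + G) \<le> norm F + norm G"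
    by transfer (auto intro: onorm_triangle dest: bounded_clinearD)
  show "norm (r *\<^sub>R F) = \<bar>r\<bar> * norm F"
    by transfer (auto intro: onorm_scaleR dest: bounded_clinearD)
  show "norm (c *\<^sub>C F) = cmod c * norm F"
  proof (transfer fixing: c)
    fix f :: "'a \<Rightarrow> 'b"
    assume "bounded_clinear f"
    then have f: "bounded_linear f"
      by (rule bounded_clinearD)
    have "onorm (\<lambda>x. c *\<^sub>C f x) = onorm (\<lambda>x. cmod c *\<^sub>R f x)"
      by (simp add: onorm_def norm_scaleC)
    also have "\<dots> = cmod c * onorm f"
      using onorm_scaleR[OF f, of "cmod c"] by simp
    finally show "onorm (\<lambda>x. c *\<^sub>C f x) = cmod c * onorm f" .
  qed
qed

end

lemma norm_cblinfun: "norm (F *\<^sub>V x) \<le> norm F * norm x"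
  by transfer (auto intro: onorm dest: bounded_clinearD)

lemma norm_cblinfun_bound: "0 \<le> K \<Longrightarrow> (\<And>x. norm (F *\<^sub>V x) \<le> K * norm x) \<Longrightarrow> norm F \<le> K"
  by transfer (rule onorm_bound)

instance cblinfun :: (complex_normed_vector, complex_banach) complex_banach
proof
  fix X :: "nat \<Rightarrow> 'a \<Rightarrow>\<^sub>C\<^sub>L 'b"
  assume X: "Cauchy X"
  define Y where "Y n = Blinfun (cblinfun_apply (X n))" for n
  have bl: "bounded_linear (cblinfun_apply F)" for F :: "'a \<Rightarrow>\<^sub>C\<^sub>L 'b"
    using cblinfun_apply[of F] by (auto dest: bounded_clinearD)
  have Y: "blinfun_apply (Y n) x = X n *\<^sub>V x" for n x
    by (simp add: Y_def bounded_linear_Blinfun_apply bl)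
  have "norm (Y m - Y n) \<le> norm (X m - X n)" for m n
  proof (rule norm_blinfun_bound)
    show "norm (blinfun_apply (Y m - Y n) x) \<le> norm (X m - X n) * norm x" for x
      using norm_cblinfun[of "X m - X n" x]
      by (simp add: blinfun.diff_left Y minus_cblinfun.rep_eq)
  qed simp
  then have "Cauchy Y"
    using X unfolding Cauchy_def dist_norm by (meson le_less_trans)
  then obtain L where L: "Y \<longlonglongrightarrow> L"
    using convergent_def Cauchy_convergent_iff by blast
  have lim: "(\<lambda>n. X n *\<^sub>V x) \<longlonglongrightarrow> blinfun_apply L x" for x
    using blinfun.tendsto[OF L tendsto_const[of x]] by (simp add: Y)
  have hom: "blinfun_apply L (c *\<^sub>C x) = c *\<^sub>C blinfun_apply L x" for c x
  proof (rule LIMSEQ_unique[OF lim])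
    have "X n *\<^sub>V c *\<^sub>C x = c *\<^sub>C (X n *\<^sub>V x)" for n
      using cblinfun_apply[of "X n"] by (auto dest: bounded_clinearD)
    then show "(\<lambda>n. X n *\<^sub>V c *\<^sub>C x) \<longlonglongrightarrow> c *\<^sub>C blinfun_apply L x"
      using bounded_linear.tendsto[OF bounded_linear_scaleC lim] by simp
  qed
  define M where "M = CBlinfun (blinfun_apply L)"
  have M: "M *\<^sub>V x = blinfun_apply L x" for x
    unfolding M_def by (subst CBlinfun_inverse)
      (auto simp: bounded_clinear_def hom blinfun.bounded_linear_right)
  have le: "norm (X n - M) \<le> norm (Y n - L)" for n
  proof (rule norm_cblinfun_bound)
    show "norm ((X n - M) *\<^sub>V x) \<le> norm (Y n - L) * norm x" for x
      using norm_blinfun[of "Y n - L" x]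
      by (simp add: blinfun.diff_left Y M minus_cblinfun.rep_eq)
  qed simp
  have "(\<lambda>n. X n - M) \<longlonglongrightarrow> 0"
    by (rule Lim_null_comparison[OF always_eventually tendsto_norm_zero[OF LIM_zero[OF L]]])
      (simp add: le)
  then have "X \<longlonglongrightarrow> M"
    by (rule LIM_zero_cancel)
  then show "convergent X"
    by (auto simp: convergent_def)
qed

lift_definition id_cblinfun :: "'a::complex_normed_vector \<Rightarrow>\<^sub>C\<^sub>L 'a" is "\<lambda>x. x"
  by (rule bounded_clinear_ident)

lift_definition cblinfun_compose ::
  "('b::complex_normed_vector \<Rightarrow>\<^sub>C\<^sub>L 'c::complex_normed_vector) \<Rightarrow>
    ('a::complex_normed_vector \<Rightarrow>\<^sub>C\<^sub>L 'b) \<Rightarrow> ('a \<Rightarrow>\<^sub>C\<^sub>L 'c)" (infixl "o\<^sub>C\<^sub>L" 67)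
  is "\<lambda>f g x. f (g x)" by (rule bounded_clinear_compose)

lemma norm_cblinfun_compose: "norm (F o\<^sub>C\<^sub>L G) \<le> norm F * norm G"
  by transfer (auto intro: onorm_compose[unfolded o_def] dest: bounded_clinearD)

lemma cblinfun_compose_linear:
  shows "(F + F') o\<^sub>C\<^sub>L G = F o\<^sub>C\<^sub>L G + F' o\<^sub>C\<^sub>L G" "F o\<^sub>C\<^sub>L (G + G') = F o\<^sub>C\<^sub>L G + F o\<^sub>C\<^sub>L G'"
    and "(c *\<^sub>C F) o\<^sub>C\<^sub>L G = c *\<^sub>C (F o\<^sub>C\<^sub>L G)" "F o\<^sub>C\<^sub>L (c *\<^sub>C G) = c *\<^sub>C (F o\<^sub>C\<^sub>L G)"
  by (transfer; auto simp: fun_eq_iff linear_add bounded_linear.linear dest: bounded_clinearD)+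

lemma bounded_clinearI:
  assumes "\<And>x y. f (x + y) = f x + f y" "\<And>c x. f (c *\<^sub>C x) = c *\<^sub>C f x"
    and "\<And>x. norm (f x) \<le> norm x * K"
  shows "bounded_clinear f"
  unfolding bounded_clinear_def
proof (intro conjI allI)
  show "bounded_linear f"
    by (rule bounded_linear_intro[where K = K])
      (use assms in \<open>simp_all flip: scaleC_of_real\<close>)
qed (rule assms)

lemma bounded_clinear_compose_left: "bounded_clinear (\<lambda>U. F o\<^sub>C\<^sub>L U)"
  by (rule bounded_clinearI[where K = "norm F"])
    (use norm_cblinfun_compose[of F] in \<open>simp_all add: cblinfun_compose_linear mult.commute\<close>)

lemma bounded_clinear_compose_right: "bounded_clinear (\<lambda>U. U o\<^sub>C\<^sub>L F)"
  by (rule bounded_clinearI[where K = "norm F"])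
    (use norm_cblinfun_compose[of _ F] in \<open>simp_all add: cblinfun_compose_linear\<close>)

type_synonym 'a dual = "'a \<Rightarrow>\<^sub>C\<^sub>L complex"

lift_definition banach_adjoint ::
  "('a::complex_normed_vector \<Rightarrow>\<^sub>C\<^sub>L 'b::complex_normed_vector) \<Rightarrow> ('b dual \<Rightarrow>\<^sub>C\<^sub>L 'a dual)"
  is "\<lambda>T f. f o\<^sub>C\<^sub>L T" by (rule bounded_clinear_compose_right)

lift_definition generalized_derivation ::
  "('x::complex_banach \<Rightarrow>\<^sub>C\<^sub>L 'x) \<Rightarrow> ('y::complex_banach \<Rightarrow>\<^sub>C\<^sub>L 'y) \<Rightarrow>
    (('y \<Rightarrow>\<^sub>C\<^sub>L 'x) \<Rightarrow>\<^sub>C\<^sub>L ('y \<Rightarrow>\<^sub>C\<^sub>L 'x))"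
  is "\<lambda>A B U. A o\<^sub>C\<^sub>L U - U o\<^sub>C\<^sub>L B"
  by (intro bounded_clinear_diff bounded_clinear_compose_left bounded_clinear_compose_right)


section \<open>Spectra and isoloid operators\<close>

definition iso :: "complex set \<Rightarrow> complex set"
  where "iso K = {z. z isolated_in K}"

definition null_space :: "('a::complex_normed_vector \<Rightarrow>\<^sub>C\<^sub>L 'b::complex_normed_vector) \<Rightarrow> 'a set"
  where "null_space T = {x. T *\<^sub>V x = 0}"

definition nullity :: "('a::complex_normed_vector \<Rightarrow>\<^sub>C\<^sub>L 'b::complex_normed_vector) \<Rightarrow> enat"
  where "nullity T = cdimension (null_space T)"

definition invertible_op :: "('a::complex_banach \<Rightarrow>\<^sub>C\<^sub>L 'a) \<Rightarrow> bool"
  where "invertible_op T \<longleftrightarrow> (\<exists>S. S o\<^sub>C\<^sub>L T = id_cblinfun \<and> T o\<^sub>C\<^sub>L S = id_cblinfun)"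

definition bounded_below_op :: "('a::complex_banach \<Rightarrow>\<^sub>C\<^sub>L 'a) \<Rightarrow> bool"
  where "bounded_below_op T \<longleftrightarrow>
    inj (cblinfun_apply T) \<and> closed (range (cblinfun_apply T))"

definition spectrum :: "('a::complex_banach \<Rightarrow>\<^sub>C\<^sub>L 'a) \<Rightarrow> complex set"
  where "spectrum T = {z. \<not> invertible_op (T - z *\<^sub>C id_cblinfun)}"

definition approx_spectrum :: "('a::complex_banach \<Rightarrow>\<^sub>C\<^sub>L 'a) \<Rightarrow> complex set"
  where "approx_spectrum T = {z. \<not> bounded_below_op (T - z *\<^sub>C id_cblinfun)}"

definition isolated_eigenvalues :: "('a::complex_banach \<Rightarrow>\<^sub>C\<^sub>L 'a) \<Rightarrow> complex set"
  where "isolated_eigenvalues T =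
    {z \<in> iso (spectrum T). 0 < nullity (T - z *\<^sub>C id_cblinfun)}"

definition a_isolated_eigenvalues :: "('a::complex_banach \<Rightarrow>\<^sub>C\<^sub>L 'a) \<Rightarrow> complex set"
  where "a_isolated_eigenvalues T =
    {z \<in> iso (approx_spectrum T). 0 < nullity (T - z *\<^sub>C id_cblinfun)}"

definition isoloid :: "('a::complex_banach \<Rightarrow>\<^sub>C\<^sub>L 'a) \<Rightarrow> bool"
  where "isoloid T \<longleftrightarrow> iso (spectrum T) = isolated_eigenvalues T"

definition a_isoloid :: "('a::complex_banach \<Rightarrow>\<^sub>C\<^sub>L 'a) \<Rightarrow> bool"
  where "a_isoloid T \<longleftrightarrow> iso (approx_spectrum T) = a_isolated_eigenvalues T"

end

theory Submission
  imports Defs "HOL-Complex_Analysis.Complex_Analysis"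
begin

text \<open>The approximate point spectrum of \<open>U \<mapsto> A U - U B\<close> is exactly the difference of those of \<open>A\<close> and
  of the adjoint of \<open>B\<close>, and its spectrum contains the difference of the spectra. An isolated point
  of the spectrum is a boundary point, hence an approximate eigenvalue. So an isolated point of either
  kind splits as \<open>a - b\<close>, where \<open>a\<close> and \<open>b\<close> must be isolated too: otherwise moving one of them
  would produce nearby points of the spectrum of the derivation. Eigenvectors \<open>x\<close> of \<open>A\<close> and
  \<open>f\<close> of the adjoint of \<open>B\<close> then give the rank one eigenvector \<open>y \<mapsto> f(y) x\<close>.

  The inclusions from right to left come from rank one operators built from approximate eigenvectors.
  The other one is a joint approximate eigenvalue argument: a seminorm on operators
  commuting with \<open>A\<close>, formed along an approximate eigenvector of the derivation, for which left
  multiplication by \<open>A\<close> has an approximate eigenvalue by Liouville's theorem.\<close>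

section \<open>The Hahn-Banach theorem\<close>

text \<open>The inclusion for the spectra needs more than rank one operators. Approximate
  eigenvectors of \<open>A\<close> and of the adjoint of \<open>B\<close> keep the derivation from
  being bounded below; those of the adjoint of \<open>A\<close> and of \<open>B\<close> keep it from
  being both bounded below and onto. Neither pair is available when \<open>A - a\<close> and
  \<open>B - b\<close> are both bounded below but not onto, or both onto but not bounded below.
  Boundary points of a spectrum are approximate eigenvalues of the operator and of its adjoint, so
  in these cases \<open>a\<close> and \<open>b\<close> are interior and can be moved. The full
  spectra cannot be avoided: \<open>a\<close> and \<open>b\<close> are found among approximate
  eigenvalues, but being isoloid concerns isolation in the whole spectrum.

  In the other inclusion the obstacle is completeness. The operators commuting with \<open>A\<close>
  need not be complete in the limsup seminorm, so a lower bound and dense range do not yield a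
  resolvent there. Hahn-Banach moves the argument to functionals, where solutions exist without
  taking limits of operators.\<close>

definition sublinear :: "('a::real_vector \<Rightarrow> real) \<Rightarrow> bool"
  where "sublinear p \<longleftrightarrow>
    (\<forall>x y. p (x + y) \<le> p x + p y) \<and> (\<forall>r>0. \<forall>x. p (r *\<^sub>R x) \<le> r * p x)"

lemma sublinearD:
  assumes "sublinear p"
  shows "p (x + y) \<le> p x + p y" "r > 0 \<Longrightarrow> p (r *\<^sub>R x) \<le> r * p x"
  using assms by (auto simp: sublinear_def)

lemma sublinear_0:
  assumes "sublinear p"
  shows "p 0 = 0"
  using sublinearD(2)[OF assms, of 2 0] sublinearD(2)[OF assms, of "1/2" 0] by simp

lemma sublinear_scaleR:
  assumes "sublinear p" "r \<ge> 0"
  shows "p (r *\<^sub>R x) = r * p x"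
proof (cases "r = 0")
  case False
  with assms have "r > 0" by simp
  then have "p (inverse r *\<^sub>R r *\<^sub>R x) \<le> inverse r * p (r *\<^sub>R x)"
    by (intro sublinearD(2)[OF assms(1)]) simp
  with \<open>r > 0\<close> have "r * p x \<le> p (r *\<^sub>R x)"
    by (simp add: field_simps)
  then show ?thesis
    using sublinearD(2)[OF assms(1) \<open>r > 0\<close>, of x] by simp
qed (simp add: sublinear_0[OF assms(1)])

lemma sublinear_minus_le:
  assumes "sublinear p"
  shows "- p (- x) \<le> p x"
  using sublinearD(1)[OF assms, of x "- x"] sublinear_0[OF assms] by simp

text \<open>This provides the bounds for Zorn's lemma. Every member lies above
  \<open>- p (- x)\<close>, so the infimum is finite. Comparability gives subadditivity: the smaller
  of \<open>q\<close> and \<open>q'\<close>, evaluated at \<open>x + y\<close>, is at most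
  \<open>q x + q' y\<close>.\<close>

lemma sublinear_INF_chain:
  fixes p :: "'a::real_vector \<Rightarrow> real"
  assumes "C \<noteq> {}" and sub: "\<And>q. q \<in> C \<Longrightarrow> sublinear q \<and> (\<forall>x. q x \<le> p x)"
    and chain: "\<And>q q'. q \<in> C \<Longrightarrow> q' \<in> C \<Longrightarrow> (\<forall>x. q x \<le> q' x) \<or> (\<forall>x. q' x \<le> q x)"
  defines "u \<equiv> \<lambda>x. INF q\<in>C. q x"
  shows "sublinear u" "\<And>q x. q \<in> C \<Longrightarrow> u x \<le> q x"
proof -
  have bdd: "bdd_below ((\<lambda>q. q x) ` C)" for x
  proof (rule bdd_belowI2)
    fix q assume "q \<in> C"
    with sub show "- p (- x) \<le> q x"
      using sublinear_minus_le[of q x] by (smt (verit) minus_minus)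
  qed
  show le: "u x \<le> q x" if "q \<in> C" for q x
    unfolding u_def using bdd that by (rule cINF_lower)
  have "u (x + y) \<le> u x + u y" for x y
  proof -
    have *: "u (x + y) \<le> q x + q' y" if q: "q \<in> C" "q' \<in> C" for q q'
      using chain[OF q]
    proof
      assume "\<forall>x. q x \<le> q' x"
      then show ?thesis
        using le[OF q(1), of "x + y"] sublinearD(1)[of q x y] sub[OF q(1)] by (smt (verit))
    next
      assume "\<forall>x. q' x \<le> q x"
      then show ?thesis
        using le[OF q(2), of "x + y"] sublinearD(1)[of q' x y] sub[OF q(2)] by (smt (verit))
    qed
    have "u (x + y) - q x \<le> u y" if "q \<in> C" for q
      unfolding u_def using *[OF that] \<open>C \<noteq> {}\<close>
      by (intro cINF_greatest) (simp_all add: u_def algebra_simps)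
    then have "u (x + y) - u y \<le> q x" if "q \<in> C" for q
      using that by (smt (verit))
    then have "u (x + y) - u y \<le> u x"
      unfolding u_def using \<open>C \<noteq> {}\<close> by (intro cINF_greatest) (simp_all add: u_def)
    then show ?thesis by simp
  qed
  moreover have "u (r *\<^sub>R x) \<le> r * u x" if "r > 0" for r x
  proof -
    have "u (r *\<^sub>R x) / r \<le> q x" if "q \<in> C" for q
      using le[OF that, of "r *\<^sub>R x"] sublinearD(2)[OF _ \<open>r > 0\<close>, of q x] sub[OF that] \<open>r > 0\<close>
      by (smt (verit) divide_le_eq mult.commute)
    then have "u (r *\<^sub>R x) / r \<le> u x"
      unfolding u_def using \<open>C \<noteq> {}\<close> by (intro cINF_greatest) (simp_all add: u_def)
    with that show ?thesis by (simp add: field_simps)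
  qed
  ultimately show "sublinear u"
    by (simp add: sublinear_def)
qed

text \<open>One infimal convolution serves twice: with a ray for \<open>S\<close> it shows that minimal sublinear
  functionals are odd, with a subspace for \<open>S\<close> it builds an extension into a dominating functional.\<close>

lemma sublinear_INF_cone:
  fixes p :: "'a::real_vector \<Rightarrow> real" and h :: "'b::real_vector \<Rightarrow> real" and L :: "'b \<Rightarrow> 'a"
  assumes p: "sublinear p" and "0 \<in> S"
    and S: "\<And>s t. s \<in> S \<Longrightarrow> t \<in> S \<Longrightarrow> s + t \<in> S \<and> L (s + t) = L s + L t \<and> h (s + t) = h s + h t"
      "\<And>r s. r > 0 \<Longrightarrow> s \<in> S \<Longrightarrow> r *\<^sub>R s \<in> S \<and> L (r *\<^sub>R s) = r *\<^sub>R L s \<and> h (r *\<^sub>R s) = r * h s"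
    and bd: "\<And>s. s \<in> S \<Longrightarrow> - p (- L s) \<le> h s"
  defines "u \<equiv> \<lambda>v. INF s\<in>S. h s + p (v - L s)"
  shows "sublinear u" "\<And>s v. s \<in> S \<Longrightarrow> u v \<le> h s + p (v - L s)"
proof -
  have bdd: "bdd_below ((\<lambda>s. h s + p (v - L s)) ` S)" for v
  proof (rule bdd_belowI2)
    fix s assume "s \<in> S"
    have "p (- L s) \<le> p (v - L s) + p (- v)"
      using sublinearD(1)[OF p, of "v - L s" "- v"] by simp
    with bd[OF \<open>s \<in> S\<close>] show "- p (- v) \<le> h s + p (v - L s)"
      by simp
  qed
  show le: "u v \<le> h s + p (v - L s)" if "s \<in> S" for s v
    unfolding u_def using bdd that by (rule cINF_lower)
  have ge: "c \<le> u v" if "\<And>s. s \<in> S \<Longrightarrow> c \<le> h s + p (v - L s)" for c v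
    unfolding u_def using \<open>0 \<in> S\<close> that by (intro cINF_greatest) auto
  have "u (v + w) \<le> u v + u w" for v w
  proof -
    have *: "u (v + w) \<le> (h s + p (v - L s)) + (h t + p (w - L t))" if "s \<in> S" "t \<in> S" for s t
      using le[of "s + t" "v + w"] S(1)[OF that] sublinearD(1)[OF p, of "v - L s" "w - L t"]
      by (simp add: algebra_simps)
    have "u (v + w) - (h s + p (v - L s)) \<le> u w" if "s \<in> S" for s
      using *[OF that] by (intro ge) (simp add: algebra_simps)
    then have "u (v + w) - u w \<le> u v"
      by (intro ge) (smt (verit))
    then show ?thesis by simp
  qed
  moreover have "u (r *\<^sub>R v) \<le> r * u v" if "r > 0" for r v
  proof -
    have "u (r *\<^sub>R v) / r \<le> u v"
    proof (rule ge)
      fix s assume "s \<in> S"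
      have "u (r *\<^sub>R v) \<le> r * h s + p (r *\<^sub>R (v - L s))"
        using le[of "r *\<^sub>R s" "r *\<^sub>R v"] S(2)[OF that \<open>s \<in> S\<close>] by (simp add: scaleR_diff_right)
      also have "\<dots> = r * (h s + p (v - L s))"
        using that by (simp add: sublinear_scaleR[OF p] distrib_left)
      finally show "u (r *\<^sub>R v) / r \<le> h s + p (v - L s)"
        using that by (simp add: field_simps)
    qed
    with that show ?thesis by (simp add: field_simps)
  qed
  ultimately show "sublinear u"
    by (simp add: sublinear_def)
qed

text \<open>Only oddness is missing. Lowering \<open>q\<close> along the ray through
  \<open>x\<close> gives the infimum over \<open>t \<ge> 0\<close> of
  \<open>q (v + t x) - t q x\<close>, which is below \<open>q\<close> by \<open>t = 0\<close> and
  hence equal to it; \<open>t = 1\<close> at \<open>v = - x\<close> then yields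
  \<open>q (- x) \<le> - q x\<close>.\<close>

lemma minimal_sublinear_is_linear:
  assumes q: "sublinear q" and min: "\<And>q'. sublinear q' \<Longrightarrow> (\<And>x. q' x \<le> q x) \<Longrightarrow> q' = q"
  shows "linear q"
proof -
  have odd: "q (- x) = - q x" for x
  proof -
    define u where "u v = (INF t\<in>{0::real..}. - t * q x + q (v - t *\<^sub>R (- x)))" for v
    have t: "- q (- (t *\<^sub>R (- x))) \<le> - t * q x" if "t \<in> {0..}" for t
      using that sublinear_scaleR[OF q, of t x] by simp
    note u = sublinear_INF_cone[OF q, of "{0::real..}" "\<lambda>t. t *\<^sub>R (- x)" "\<lambda>t. - t * q x",
        folded u_def, OF _ _ _ t]
    have "sublinear u"
      by (rule u) (auto simp: algebra_simps)
    moreover have le: "u v \<le> - t * q x + q (v - t *\<^sub>R (- x))" if "t \<ge> 0" for t v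
      by (rule u) (use that in \<open>auto simp: algebra_simps\<close>)
    moreover have "u v \<le> q v" for v
      using le[of 0 v] by simp
    ultimately have "u = q"
      by (intro min)
    with le[of 1 "- x"] have "q (- x) \<le> - q x"
      using sublinear_0[OF q] by simp
    then show ?thesis
      using sublinear_minus_le[OF q, of x] by simp
  qed
  have "q (x + y) = q x + q y" for x y
    using sublinearD(1)[OF q, of x y] sublinearD(1)[OF q, of "- x" "- y"] odd[of "x + y"]
    by (simp add: odd)
  moreover have "q (r *\<^sub>R x) = r * q x" for r x
    using sublinear_scaleR[OF q, of r x] sublinear_scaleR[OF q, of "- r" x] odd[of "(- r) *\<^sub>R x"]
    by (cases "r \<ge> 0") auto
  ultimately show ?thesis
    by (simp add: linear_iff)
qed

text \<open>No subspace occurs here: values to be prescribed are first built into \<open>p\<close>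
  by \<open>sublinear_INF_cone\<close>, and it remains to find a minimal sublinear functional below
  \<open>p\<close>.\<close>

theorem hahn_banach_sublinear:
  fixes p :: "'a::real_vector \<Rightarrow> real"
  assumes "sublinear p"
  obtains f where "linear f" "\<And>x. f x \<le> p x"
proof -
  define S where "S = {q. sublinear q \<and> (\<forall>x. q x \<le> p x)}"
  \<comment> \<open>The order is reversed, so that the maximal element given by Zorn's lemma is a
    minimal functional.\<close>
  define P where "P q q' \<longleftrightarrow> (\<forall>x. q' x \<le> q x)" for q q' :: "'a \<Rightarrow> real"
  have "\<exists>m\<in>S. \<forall>q\<in>S. P m q \<longrightarrow> q = m"
  proof (rule predicate_Zorn)
    show "partial_order_on S (relation_of P S)"
      by (rule partial_order_on_relation_ofI) (auto simp: P_def fun_eq_iff intro: order_trans antisym)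
    fix C assume C: "C \<in> Chains (relation_of P S)"
    then have CS: "C \<subseteq> S"
      by (auto simp: Chains_def relation_of_def)
    have chain: "(\<forall>x. q x \<le> q' x) \<or> (\<forall>x. q' x \<le> q x)" if "q \<in> C" "q' \<in> C" for q q'
      using C that by (auto simp: Chains_def relation_of_def P_def)
    show "\<exists>u\<in>S. \<forall>q\<in>C. P q u"
    proof (cases "C = {}")
      case True
      then show ?thesis using assms by (auto simp: S_def)
    next
      case False
      have sub: "sublinear q \<and> (\<forall>x. q x \<le> p x)" if "q \<in> C" for q
        using CS that by (auto simp: S_def)
      define u where "u x = (INF q\<in>C. q x)" for x
      have u: "sublinear u" "\<And>q x. q \<in> C \<Longrightarrow> u x \<le> q x"
        unfolding u_def using sublinear_INF_chain[of C p] False sub chain by blast+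
      from False obtain q where "q \<in> C" by blast
      then have "u x \<le> p x" for x
        using u(2)[of q x] sub[of q] by (meson order_trans)
      with u show ?thesis
        by (intro bexI[of _ u]) (auto simp: P_def S_def)
    qed
  qed
  then obtain m where m: "m \<in> S" "\<And>q. q \<in> S \<Longrightarrow> P m q \<Longrightarrow> q = m" by blast
  have "linear m"
  proof (rule minimal_sublinear_is_linear)
    show "sublinear m" using m(1) by (simp add: S_def)
    fix q' assume "sublinear q'" "\<And>x. q' x \<le> m x"
    then show "q' = m"
      using m(1) by (intro m(2)) (auto simp: S_def P_def intro: order_trans)
  qed
  with m(1) that show ?thesis by (auto simp: S_def)
qed

section \<open>Extension of complex linear functionals\<close>

text \<open>Boundedness is kept apart, since functionals will be bounded by seminorms other than the
  norm.\<close>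

definition clinear :: "('a::complex_normed_vector \<Rightarrow> 'b::complex_normed_vector) \<Rightarrow> bool"
  where "clinear f \<longleftrightarrow> (\<forall>x y. f (x + y) = f x + f y) \<and> (\<forall>c x. f (c *\<^sub>C x) = c *\<^sub>C f x)"

lemma clinearD:
  assumes "clinear f"
  shows "f (x + y) = f x + f y" "f (c *\<^sub>C x) = c *\<^sub>C f x" "f (r *\<^sub>R x) = r *\<^sub>R f x"
    "f 0 = 0" "f (- x) = - f x" "f (x - y) = f x - f y"
proof -
  show add: "f (x + y) = f x + f y" and "f (c *\<^sub>C x) = c *\<^sub>C f x" for x y c
    using assms by (auto simp: clinear_def)
  then show scaleR: "f (r *\<^sub>R x) = r *\<^sub>R f x" for r x
    by (simp flip: scaleC_of_real)
  show "f 0 = 0" and minus: "f (- x) = - f x" for x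
    using scaleR[of 0] scaleR[of "-1"] by simp_all
  show "f (x - y) = f x - f y"
    using add[of x "- y"] by (simp add: minus)
qed

definition cseminorm :: "('a::complex_normed_vector \<Rightarrow> real) \<Rightarrow> bool"
  where "cseminorm p \<longleftrightarrow>
    (\<forall>x y. p (x + y) \<le> p x + p y) \<and> (\<forall>c x. p (c *\<^sub>C x) = cmod c * p x)"

lemma cseminormD:
  assumes "cseminorm p"
  shows "p (x + y) \<le> p x + p y" "p (c *\<^sub>C x) = cmod c * p x" "p 0 = 0" "p (- x) = p x"
    "0 \<le> p x" "p (x - y) \<le> p x + p y" "p (x - y) = p (y - x)"
proof -
  show add: "p (x + y) \<le> p x + p y" and scale: "p (c *\<^sub>C x) = cmod c * p x" for x y c
    using assms by (auto simp: cseminorm_def)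
  show zero: "p 0 = 0"
    using scale[of 0 0] by simp
  show minus: "p (- x) = p x" for x
    using scale[of "-1" x] by simp
  show "0 \<le> p x"
    using add[of x "- x"] zero minus[of x] by simp
  show "p (x - y) \<le> p x + p y"
    using add[of x "- y"] minus[of y] by simp
  show "p (x - y) = p (y - x)"
    using minus[of "x - y"] by simp
qed

lemma cseminormI:
  assumes add: "\<And>x y. p (x + y) \<le> p x + p y" and pos: "\<And>x. 0 \<le> p x"
    and scale: "\<And>c x. p (c *\<^sub>C x) \<le> cmod c * p x"
  shows "cseminorm p"
proof -
  have "p (c *\<^sub>C x) = cmod c * p x" for c x
  proof (cases "c = 0")
    case True
    then show ?thesis
      using scale[of 0 x] pos[of 0] by simp
  next
    case False
    then have "p x \<le> p (c *\<^sub>C x) / cmod c"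
      using scale[of "inverse c" "c *\<^sub>C x"]
      by (simp add: scaleC_scaleC norm_inverse divide_inverse_commute)
    with False have "cmod c * p x \<le> p (c *\<^sub>C x)"
      by (simp add: pos_le_divide_eq mult.commute)
    with scale[of c x] show ?thesis by simp
  qed
  with add show ?thesis
    by (simp add: cseminorm_def)
qed

lemma cseminorm_norm: "cseminorm norm"
  by (simp add: cseminorm_def norm_triangle_ineq norm_scaleC)

lemma cseminorm_scale: "cseminorm p \<Longrightarrow> K \<ge> 0 \<Longrightarrow> cseminorm (\<lambda>x. K * p x)"
  by (simp add: cseminorm_def flip: distrib_left) (simp add: mult_left_mono)

lemma cseminorm_sublinear: "cseminorm p \<Longrightarrow> sublinear p"
  using cseminormD(2)[of p "of_real r" for r] by (simp add: sublinear_def cseminormD scaleC_of_real)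

text \<open>Taking the real part loses nothing: a complex functional is recovered from its real part
  \<open>f\<close> as \<open>f x - \<i> f (\<i> x)\<close>, and a rotation turns the bound on \<open>f\<close> into one on the modulus.\<close>

theorem hahn_banach_complex:
  fixes p :: "'w::complex_normed_vector \<Rightarrow> real" and L :: "'v::complex_normed_vector \<Rightarrow> 'w"
    and \<phi> :: "'v \<Rightarrow> complex"
  assumes p: "cseminorm p" and N: "complex_vector.subspace N" and L: "clinear L"
    and \<phi>: "clinear \<phi>" and le: "\<And>x. x \<in> N \<Longrightarrow> cmod (\<phi> x) \<le> p (L x)"
  obtains \<psi> where "clinear \<psi>" "\<And>w. cmod (\<psi> w) \<le> p w" "\<And>x. x \<in> N \<Longrightarrow> \<psi> (L x) = \<phi> x"
proof -
  \<comment> \<open>A linear functional below \<open>u\<close> is below \<open>p\<close> (take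
    \<open>s = 0\<close>) and below the real part of \<open>\<phi>\<close> along \<open>L\<close>;
    as \<open>N\<close> contains \<open>- s\<close> with \<open>s\<close>, the latter becomes an
    equality.\<close>
  define u where "u v = (INF s\<in>N. Re (\<phi> s) + p (v - L s))" for v
  have N0: "0 \<in> N" and Nadd: "\<And>x y. x \<in> N \<Longrightarrow> y \<in> N \<Longrightarrow> x + y \<in> N"
    and Nscale: "\<And>c x. x \<in> N \<Longrightarrow> c *\<^sub>C x \<in> N"
    using N by (auto simp: complex_vector.subspace_def)
  have NscaleR: "r *\<^sub>R x \<in> N" if "x \<in> N" for r x
    using Nscale[OF that, of "of_real r"] by (simp add: scaleC_of_real)
  have "sublinear u" and u_le: "\<And>s v. s \<in> N \<Longrightarrow> u v \<le> Re (\<phi> s) + p (v - L s)"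
    unfolding u_def
  proof -
    have bd: "- p (- L s) \<le> Re (\<phi> s)" if "s \<in> N" for s
      using le[OF that] abs_Re_le_cmod[of "\<phi> s"] by (simp add: cseminormD[OF p])
    show "sublinear (\<lambda>v. INF s\<in>N. Re (\<phi> s) + p (v - L s))"
      by (rule sublinear_INF_cone(1)[OF cseminorm_sublinear[OF p] N0 _ _ bd])
        (simp_all add: Nadd NscaleR clinearD[OF L] clinearD[OF \<phi>])
    show "(INF s\<in>N. Re (\<phi> s) + p (v - L s)) \<le> Re (\<phi> s) + p (v - L s)" if "s \<in> N" for s v
      by (rule sublinear_INF_cone(2)[OF cseminorm_sublinear[OF p] N0 _ _ bd])
        (simp_all add: Nadd NscaleR clinearD[OF L] clinearD[OF \<phi>] that)
  qed
  from hahn_banach_sublinear[OF \<open>sublinear u\<close>]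
  obtain f where f: "linear f" "\<And>x. f x \<le> u x" by blast
  define \<psi> where "\<psi> w = Complex (f w) (- f (\<i> *\<^sub>C w))" for w
  have add: "f (x + y) = f x + f y" and fR: "f (r *\<^sub>R x) = r * f x" and neg: "f (- x) = - f x" for r x y
    using f(1) by (simp_all add: linear_add linear_cmul linear_neg)
  have fle: "f w \<le> p w" for w
    using f(2)[of w] u_le[OF N0, of w] clinearD[OF L] clinearD[OF \<phi>] by simp
  have fL: "f (L x) = Re (\<phi> x)" if "x \<in> N" for x
  proof -
    have le: "f (L x) \<le> Re (\<phi> x)" if "x \<in> N" for x
      using f(2)[of "L x"] u_le[OF that, of "L x"] by (simp add: cseminormD[OF p])
    have "- x \<in> N"
      using Nscale[OF that, of "-1"] by simp
    from le[OF that] le[OF this] show ?thesis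
      by (simp add: clinearD[OF L] clinearD[OF \<phi>] neg)
  qed
  have \<psi>: "clinear \<psi>"
    unfolding clinear_def
  proof (intro conjI allI)
    show "\<psi> (x + y) = \<psi> x + \<psi> y" for x y
      by (simp add: \<psi>_def scaleC_add_right add complex_eq_iff)
    have eq: "c *\<^sub>C x = Re c *\<^sub>R x + Im c *\<^sub>R (\<i> *\<^sub>C x)" for c and x :: 'w
    proof -
      have "c = complex_of_real (Re c) + complex_of_real (Im c) * \<i>"
        using complex_eq[of c] by (simp add: mult.commute)
      then show ?thesis
        by (metis scaleC_add_left scaleC_scaleC scaleC_of_real)
    qed
    fix c and x :: 'w
    have "\<i> *\<^sub>C c *\<^sub>C x = (- Im c) *\<^sub>R x + Re c *\<^sub>R (\<i> *\<^sub>C x)"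
      using eq[of "\<i> * c" x] by (simp add: scaleC_scaleC)
    then show "\<psi> (c *\<^sub>C x) = c *\<^sub>C \<psi> x"
      using eq[of c x] linear_diff[OF f(1)] by (simp add: \<psi>_def add fR neg scaleC_complex_def complex_eq_iff)
  qed
  moreover have "cmod (\<psi> w) \<le> p w" for w
  proof -
    obtain c where c: "cmod c = 1" "c * \<psi> w = of_real (cmod (\<psi> w))"
    proof (cases "\<psi> w = 0")
      case True
      then show ?thesis using that[of 1] by simp
    next
      case False
      then show ?thesis
        using that[of "of_real (cmod (\<psi> w)) / \<psi> w"] by (simp add: norm_divide)
    qed
    have "cmod (\<psi> w) = Re (\<psi> (c *\<^sub>C w))"
      using c(2) by (simp add: clinearD[OF \<psi>] scaleC_complex_def)
    also have "\<dots> \<le> p w"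
      using fle[of "c *\<^sub>C w"] c(1) by (simp add: \<psi>_def cseminormD[OF p])
    finally show ?thesis .
  qed
  moreover have "\<psi> (L x) = \<phi> x" if "x \<in> N" for x
  proof -
    have "f (\<i> *\<^sub>C L x) = - Im (\<phi> x)"
      using fL[OF Nscale[OF that, of \<i>]]
      by (simp add: clinearD[OF L] clinearD[OF \<phi>] scaleC_complex_def)
    with fL[OF that] show ?thesis
      by (simp add: \<psi>_def complex_eq_iff)
  qed
  ultimately show ?thesis
    by (rule that)
qed

text \<open>Extending \<open>c * p x\<close> along the map that takes \<open>c\<close> to the
  multiple of \<open>x\<close> by \<open>c\<close> avoids a case distinction: that map may fail to
  be injective.\<close>

lemma norming_functional:
  fixes p :: "'v::complex_normed_vector \<Rightarrow> real"
  assumes p: "cseminorm p"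
  obtains \<psi> where "clinear \<psi>" "\<And>w. cmod (\<psi> w) \<le> p w" "\<psi> x = p x"
proof (rule hahn_banach_complex[OF p complex_vector.subspace_UNIV])
  show "clinear (\<lambda>c. c *\<^sub>C x)" "clinear (\<lambda>c. c * complex_of_real (p x))"
    by (auto simp: clinear_def scaleC_add_left scaleC_scaleC scaleC_complex_def algebra_simps)
  show "cmod (c * complex_of_real (p x)) \<le> p (c *\<^sub>C x)" for c
    by (simp add: norm_mult cseminormD[OF p])
  fix \<psi> :: "'v \<Rightarrow> complex"
  assume "clinear \<psi>" "\<And>w. cmod (\<psi> w) \<le> p w"
    and "\<And>c. c \<in> UNIV \<Longrightarrow> \<psi> (c *\<^sub>C x) = c * complex_of_real (p x)"
  then show thesis
    using that[of \<psi>] by (metis UNIV_I mult_1 scaleC_one)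
qed

section \<open>Bounded operators and dual spaces\<close>

lemma cblinfun_linear [simp]:
  fixes F :: "'a::complex_normed_vector \<Rightarrow>\<^sub>C\<^sub>L 'b::complex_normed_vector"
  shows "F *\<^sub>V (x + y) = F *\<^sub>V x + F *\<^sub>V y" "F *\<^sub>V (c *\<^sub>C x) = c *\<^sub>C (F *\<^sub>V x)"
    "F *\<^sub>V (r *\<^sub>R x) = r *\<^sub>R (F *\<^sub>V x)" "F *\<^sub>V 0 = 0" "F *\<^sub>V (- x) = - (F *\<^sub>V x)"
    "F *\<^sub>V (x - y) = F *\<^sub>V x - F *\<^sub>V y"
proof -
  have "bounded_clinear (cblinfun_apply F)"
    using cblinfun_apply[of F] by simp
  then have "clinear (cblinfun_apply F)"
    by (auto simp: clinear_def bounded_clinear_def linear_add bounded_linear.linear)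
  from clinearD[OF this] show "F *\<^sub>V (x + y) = F *\<^sub>V x + F *\<^sub>V y"
    "F *\<^sub>V (c *\<^sub>C x) = c *\<^sub>C (F *\<^sub>V x)"
    "F *\<^sub>V (r *\<^sub>R x) = r *\<^sub>R (F *\<^sub>V x)" "F *\<^sub>V 0 = 0" "F *\<^sub>V (- x) = - (F *\<^sub>V x)"
    "F *\<^sub>V (x - y) = F *\<^sub>V x - F *\<^sub>V y" by blast+
qed

lemma bounded_linear_cblinfun: "bounded_linear (cblinfun_apply F)"
  using cblinfun_apply[of F] by (auto dest: bounded_clinearD)

lemma clinear_cblinfun: "clinear (cblinfun_apply F)"
  by (simp add: clinear_def)

lemmas cblinfun_rep_eq [simp] =
  zero_cblinfun.rep_eq plus_cblinfun.rep_eq minus_cblinfun.rep_eq uminus_cblinfun.rep_eq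
  scaleC_cblinfun.rep_eq scaleR_cblinfun.rep_eq id_cblinfun.rep_eq cblinfun_compose.rep_eq
  banach_adjoint.rep_eq generalized_derivation.rep_eq

lemma cblinfun_compose_zero [simp]: "F o\<^sub>C\<^sub>L 0 = 0" "0 o\<^sub>C\<^sub>L F = 0"
  by (rule cblinfun_eqI; simp)+

lemma bounded_clinear_of_clinear:
  assumes "clinear f" "\<And>x. norm (f x) \<le> K * norm x"
  shows "bounded_clinear f"
  by (rule bounded_clinearI[where K = K]) (use assms in \<open>simp_all add: clinear_def mult.commute\<close>)

lemma cblinfun_of_clinear:
  assumes "clinear f" "0 \<le> K" "\<And>x. norm (f x) \<le> K * norm x"
  obtains F where "cblinfun_apply F = f" "norm F \<le> K"
proof -
  have eq: "cblinfun_apply (CBlinfun f) = f"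
    using bounded_clinear_of_clinear[OF assms(1,3)] by (simp add: CBlinfun_inverse)
  then have "norm (CBlinfun f) \<le> K"
    using assms by (intro norm_cblinfun_bound) auto
  with eq that show ?thesis by blast
qed

lemma norm_cblinfun_approx:
  assumes "0 \<le> r" "r < norm F"
  obtains x where "norm x = 1" "r < norm (F *\<^sub>V x)"
proof -
  have "\<not> (\<forall>x. norm (F *\<^sub>V x) \<le> r * norm x)"
    using norm_cblinfun_bound[OF assms(1), of F] assms(2) by fastforce
  then obtain x where x: "r * norm x < norm (F *\<^sub>V x)"
    by (auto simp: not_le)
  then have "x \<noteq> 0" by auto
  show ?thesis
    by (rule that[of "x /\<^sub>R norm x"]) (use x \<open>x \<noteq> 0\<close> in \<open>simp_all add: field_simps\<close>)
qed

lemma dual_norming: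
  fixes x :: "'a::complex_normed_vector"
  obtains g :: "'a dual" where "norm g \<le> 1" "g *\<^sub>V x = norm x"
proof -
  obtain \<psi> :: "'a \<Rightarrow> complex" where "clinear \<psi>" "\<And>w. cmod (\<psi> w) \<le> norm w" "\<psi> x = norm x"
    using norming_functional[OF cseminorm_norm] by blast
  moreover from this obtain F where "cblinfun_apply F = \<psi>" "norm F \<le> 1"
    using cblinfun_of_clinear[of \<psi> 1] by auto
  ultimately show ?thesis
    using that by metis
qed

text \<open>The distance to a subspace is a seminorm. A functional norming \<open>y\<close> for it
  vanishes on \<open>R\<close>, and it is nonzero because \<open>R\<close> is closed and misses
  \<open>y\<close>.\<close>

lemma dual_separation:
  fixes R :: "'a::complex_normed_vector set"
  assumes "complex_vector.subspace R" "closed R" "y \<notin> R"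
  obtains g :: "'a dual" where "g \<noteq> 0" "\<And>x. x \<in> R \<Longrightarrow> g *\<^sub>V x = 0"
proof -
  have R: "0 \<in> R" "\<And>x y. x \<in> R \<Longrightarrow> y \<in> R \<Longrightarrow> x + y \<in> R" "\<And>c x. x \<in> R \<Longrightarrow> c *\<^sub>C x \<in> R"
    using assms(1) by (auto simp: complex_vector.subspace_def)
  define p where "p x = infdist x R" for x
  have le: "p x \<le> norm (x - r)" if "r \<in> R" for x r
    unfolding p_def using infdist_le[OF that, of x] by (simp add: dist_norm)
  have ge: "c \<le> p x" if "\<And>r. r \<in> R \<Longrightarrow> c \<le> norm (x - r)" for c x
    unfolding p_def using R(1) that by (auto simp: infdist_def dist_norm intro!: cINF_greatest)
  have add: "p (x + y) \<le> p x + p y" for x y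
  proof -
    have "p (x + y) \<le> norm (x - r) + norm (y - s)" if "r \<in> R" "s \<in> R" for r s
      using le[OF R(2)[OF that], of "x + y"] norm_triangle_ineq[of "x - r" "y - s"]
      by (simp add: algebra_simps)
    then have "p (x + y) - norm (x - r) \<le> p y" if "r \<in> R" for r
      using that by (intro ge) (smt (verit))
    then have "p (x + y) - p y \<le> p x"
      by (intro ge) (smt (verit))
    then show ?thesis by simp
  qed
  have "p (c *\<^sub>C x) \<le> cmod c * p x" for c x
  proof (cases "c = 0")
    case True
    then show ?thesis using R(1) by (simp add: p_def)
  next
    case False
    have "p (c *\<^sub>C x) / cmod c \<le> p x"
    proof (rule ge)
      fix r assume "r \<in> R"
      have "p (c *\<^sub>C x) \<le> norm (c *\<^sub>C x - c *\<^sub>C r)"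
        by (rule le[OF R(3)[OF \<open>r \<in> R\<close>]])
      also have "\<dots> = cmod c * norm (x - r)"
        by (simp add: norm_scaleC flip: complex_vector.scale_right_diff_distrib)
      finally show "p (c *\<^sub>C x) / cmod c \<le> norm (x - r)"
        using False by (simp add: divide_le_eq mult.commute)
    qed
    with False show ?thesis by (simp add: divide_le_eq mult.commute)
  qed
  with add have p: "cseminorm p"
    by (intro cseminormI) (auto simp: p_def infdist_nonneg)
  then obtain \<psi> where \<psi>: "clinear \<psi>" "\<And>w. cmod (\<psi> w) \<le> p w" "\<psi> y = p y"
    using norming_functional by blast
  have "cmod (\<psi> w) \<le> 1 * norm w" for w
    using \<psi>(2)[of w] le[OF R(1), of w] by simp
  with \<psi>(1) obtain F where F: "cblinfun_apply F = \<psi>"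
    using cblinfun_of_clinear[of \<psi> 1] by auto
  have "p y \<noteq> 0"
    using assms R(1) in_closed_iff_infdist_zero[of R y] by (auto simp: p_def)
  with \<psi>(3) F have "F \<noteq> 0" by auto
  moreover have "F *\<^sub>V x = 0" if "x \<in> R" for x
    using \<psi>(2)[of x] that F by (simp add: p_def)
  ultimately show ?thesis
    by (rule that)
qed

section \<open>Lower bounds and invertibility\<close>

text \<open>The quantitative form of \<open>bounded_below_op\<close>; the two agree on Banach spaces
  by the open mapping argument below, see \<open>bounded_below_op_iff\<close>.\<close>

definition lower_bounded :: "('a::complex_normed_vector \<Rightarrow>\<^sub>C\<^sub>L 'b::complex_normed_vector) \<Rightarrow> bool"
  where "lower_bounded T \<longleftrightarrow> (\<exists>c>0. \<forall>x. c * norm x \<le> norm (T *\<^sub>V x))"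

lemma not_lower_boundedE:
  assumes "\<not> lower_bounded T" "e > 0"
  obtains x where "norm x = 1" "norm (T *\<^sub>V x) < e"
proof -
  obtain x where x: "norm (T *\<^sub>V x) < e * norm x"
    using assms by (auto simp: lower_bounded_def not_le)
  then have "x \<noteq> 0" by auto
  show ?thesis
    by (rule that[of "x /\<^sub>R norm x"]) (use x \<open>x \<noteq> 0\<close> in \<open>simp_all add: field_simps\<close>)
qed

section \<open>Lower bounds, injectivity and closed range\<close>

lemma lower_bounded_inj:
  assumes "lower_bounded T"
  shows "inj (cblinfun_apply T)"
proof (rule injI)
  fix x y assume "T *\<^sub>V x = T *\<^sub>V y"
  then have "norm (T *\<^sub>V (x - y)) = 0" by simp
  moreover obtain c where "c > 0" "c * norm (x - y) \<le> norm (T *\<^sub>V (x - y))"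
    using assms unfolding lower_bounded_def by blast
  ultimately have "norm (x - y) \<le> 0"
    by (simp add: mult_le_0_iff)
  then show "x = y" by simp
qed

lemma lower_bounded_closed_range:
  fixes T :: "'a::complex_banach \<Rightarrow>\<^sub>C\<^sub>L 'b::complex_banach"
  assumes "lower_bounded T"
  shows "closed (range (cblinfun_apply T))"
  using assms complete_isometric_image[OF _ subspace_UNIV bounded_linear_cblinfun _ complete_UNIV, of _ T]
  by (auto simp: lower_bounded_def complete_eq_closed)

text \<open>This is the Baire half of the open mapping theorem, carried out in the closed range
  \<open>R\<close>: some \<open>C n\<close> contains a relative ball around a point
  \<open>y0\<close>, and a small vector of \<open>R\<close> is a difference of two points of that
  ball.\<close>

lemma closed_range_almost_open:
  fixes T :: "'a::complex_banach \<Rightarrow>\<^sub>C\<^sub>L 'b::complex_banach"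
  assumes cl: "closed (range (cblinfun_apply T))"
  obtains K where "K \<ge> 0"
    "\<And>y e. y \<in> range (cblinfun_apply T) \<Longrightarrow> e > 0 \<Longrightarrow> \<exists>x. norm x \<le> K * norm y \<and> norm (T *\<^sub>V x - y) < e"
proof -
  define R where "R = range (cblinfun_apply T)"
  define C where "C n = closure (cblinfun_apply T ` cball 0 (real n))" for n :: nat
  have CR: "C n \<subseteq> R" for n
    unfolding C_def R_def using cl by (intro closure_minimal) auto
  have "\<Union> (range C) = R"
  proof
    show "\<Union> (range C) \<subseteq> R" using CR by blast
    show "R \<subseteq> \<Union> (range C)"
    proof
      fix y assume "y \<in> R"
      then obtain x where x: "y = T *\<^sub>V x" by (auto simp: R_def)
      obtain n where "norm x \<le> real n" using real_arch_simple by blast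
      with x have "y \<in> C n"
        unfolding C_def by (intro subsetD[OF closure_subset]) auto
      then show "y \<in> \<Union> (range C)" by blast
    qed
  qed
  moreover have "top_of_set R interior_of R = R"
    by (metis interior_of_topspace topspace_euclidean_subtopology)
  moreover have "0 \<in> R"
    by (metis R_def cblinfun_linear(4) rangeI)
  ultimately have "top_of_set R interior_of \<Union> (range C) \<noteq> {}" by auto
  moreover have "completely_metrizable_space (top_of_set R)"
    using cl unfolding R_def
    by (intro completely_metrizable_space_closedin completely_metrizable_space_euclidean) simp
  moreover have "closedin (top_of_set R) (C n)" for n
    using CR[of n] by (intro closed_subset) (simp_all add: C_def)
  ultimately obtain n where "top_of_set R interior_of C n \<noteq> {}"
    using Baire_category_alt[of "top_of_set R" "range C"] by auto
  then obtain y0 U where U: "y0 \<in> U" "U \<subseteq> C n" "openin (top_of_set R) U"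
    by (auto simp: interior_of_def)
  then obtain r where r: "r > 0" "ball y0 r \<inter> R \<subseteq> C n"
    by (meson openin_contains_ball subset_trans)
  have "y0 \<in> R" using U CR by blast
  have ap: "\<exists>x. norm x \<le> (4 * n / r) * norm y \<and> norm (T *\<^sub>V x - y) < e" if "y \<in> R" "e > 0" for y e
  proof (cases "y = 0")
    case True
    then show ?thesis using that by (intro exI[of _ 0]) simp
  next
    case False
    \<comment> \<open>With this scale \<open>y\<close> divided by \<open>s\<close> has norm
      \<open>r / 2\<close> and stays in the ball around \<open>y0\<close>. Multiplying a difference
      of two vectors of norm at most \<open>n\<close> by \<open>s\<close> gives the factor
      \<open>4 * n / r\<close>.\<close>
    define s where "s = 2 * norm y / r"
    have "s > 0" using False r by (simp add: s_def)
    have "y0 + y /\<^sub>R s \<in> R"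
    proof -
      obtain a b where "y0 = T *\<^sub>V a" "y = T *\<^sub>V b"
        using \<open>y0 \<in> R\<close> \<open>y \<in> R\<close> by (auto simp: R_def)
      then have "y0 + y /\<^sub>R s = T *\<^sub>V (a + b /\<^sub>R s)" by simp
      then show ?thesis unfolding R_def by (rule range_eqI)
    qed
    moreover have "y0 + y /\<^sub>R s \<in> ball y0 r"
      using False r by (simp add: s_def dist_norm)
    ultimately have "y0 + y /\<^sub>R s \<in> C n" using r by blast
    moreover have "y0 \<in> C n" using U by blast
    moreover have "e / s / 2 > 0" using \<open>s > 0\<close> \<open>e > 0\<close> by simp
    ultimately obtain x1 x2 where x: "norm x1 \<le> n" "norm x2 \<le> n"
        "norm (T *\<^sub>V x1 - (y0 + y /\<^sub>R s)) < e / s / 2" "norm (T *\<^sub>V x2 - y0) < e / s / 2"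
      unfolding C_def closure_approachable by (fastforce simp: dist_norm)
    have "norm (x1 - x2) \<le> 2 * n"
      using norm_triangle_ineq4[of x1 x2] x by simp
    then have "s * norm (x1 - x2) \<le> s * (2 * n)"
      using \<open>s > 0\<close> by (intro mult_left_mono) auto
    then have "norm (s *\<^sub>R (x1 - x2)) \<le> (4 * n / r) * norm y"
      using \<open>s > 0\<close> r(1) by (simp add: s_def mult_ac)
    moreover have "norm (T *\<^sub>V (s *\<^sub>R (x1 - x2)) - y) < e"
    proof -
      have "T *\<^sub>V (s *\<^sub>R (x1 - x2)) - y = s *\<^sub>R ((T *\<^sub>V x1 - (y0 + y /\<^sub>R s)) - (T *\<^sub>V x2 - y0))"
        using \<open>s > 0\<close> by (simp add: scaleR_diff_right scaleR_add_right)
      then have "norm (T *\<^sub>V (s *\<^sub>R (x1 - x2)) - y) =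
          s * norm ((T *\<^sub>V x1 - (y0 + y /\<^sub>R s)) - (T *\<^sub>V x2 - y0))"
        using \<open>s > 0\<close> by simp
      also have "\<dots> < s * (e / s)"
        using norm_triangle_ineq4[of "T *\<^sub>V x1 - (y0 + y /\<^sub>R s)" "T *\<^sub>V x2 - y0"] x \<open>s > 0\<close>
        by (intro mult_strict_left_mono) auto
      finally show ?thesis using \<open>s > 0\<close> by simp
    qed
    ultimately show ?thesis by blast
  qed
  show ?thesis
    by (rule that[of "4 * n / r"]) (use r ap in \<open>auto simp: R_def\<close>)
qed

text \<open>Solving approximately with half the error left, and repeating on the remainder, produces
  a series of norm at most \<open>2 * K * norm y\<close> that solves the equation exactly.
  Injectivity identifies its sum with the given preimage.\<close>

lemma closed_range_inj_lower_bounded: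
  fixes T :: "'a::complex_banach \<Rightarrow>\<^sub>C\<^sub>L 'b::complex_banach"
  assumes cl: "closed (range (cblinfun_apply T))" and inj: "inj (cblinfun_apply T)"
  shows "lower_bounded T"
proof -
  obtain K where K: "K \<ge> 0"
    "\<And>y e. y \<in> range (cblinfun_apply T) \<Longrightarrow> e > 0 \<Longrightarrow> \<exists>x. norm x \<le> K * norm y \<and> norm (T *\<^sub>V x - y) < e"
    using closed_range_almost_open[OF cl] by blast
  have "\<exists>x. norm x \<le> K * norm y \<and> norm (y - T *\<^sub>V x) \<le> norm y / 2"
    if "y \<in> range (cblinfun_apply T)" for y
  proof (cases "y = 0")
    case False
    then show ?thesis
      using K(2)[OF that, of "norm y / 2"] by (force simp: norm_minus_commute)
  qed (auto intro: exI[of _ 0])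
  then obtain g where g: "norm (g y) \<le> K * norm y" "norm (y - T *\<^sub>V g y) \<le> norm y / 2"
    if "y \<in> range (cblinfun_apply T)" for y
    by metis
  have "norm x0 \<le> (2 * K) * norm (T *\<^sub>V x0)" for x0
  proof -
    define y where "y = T *\<^sub>V x0"
    \<comment> \<open>\<open>v n\<close> is the remainder still to be hit after \<open>n\<close>
      corrections.\<close>
    define v where "v = rec_nat y (\<lambda>_ w. w - T *\<^sub>V g w)"
    have v_Suc: "v (Suc n) = v n - T *\<^sub>V g (v n)" and v0: "v 0 = y" for n
      by (simp_all add: v_def)
    have vR: "v n \<in> range (cblinfun_apply T)" for n
    proof (induction n)
      case (Suc n)
      then obtain x where "v n = T *\<^sub>V x" by auto
      then have "v (Suc n) = T *\<^sub>V (x - g (v n))" by (simp add: v_Suc)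
      then show ?case by (rule range_eqI)
    qed (simp add: v0 y_def)
    have v_le: "norm (v n) \<le> norm y * (1/2) ^ n" for n
    proof (induction n)
      case (Suc n)
      then show ?case using g(2)[OF vR, of n] by (simp add: v_Suc)
    qed (simp add: v0)
    have le: "norm (g (v n)) \<le> K * norm y * (1/2) ^ n" for n
      using g(1)[OF vR, of n] mult_left_mono[OF v_le \<open>K \<ge> 0\<close>, of n] by (simp add: mult.assoc)
    have gs: "(\<lambda>n. K * norm y * (1/2) ^ n) sums (K * norm y * 2)"
      using sums_mult[OF geometric_sums[of "1/2 :: real"], of "K * norm y"] by simp
    then have sn: "summable (\<lambda>n. norm (g (v n)))"
      using le by (intro summable_comparison_test'[OF sums_summable]) auto
    then have s: "summable (\<lambda>n. g (v n))"
      by (rule summable_norm_cancel)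
    have partial: "T *\<^sub>V (\<Sum>k<n. g (v k)) = y - v n" for n
      by (induction n) (simp_all add: v0 v_Suc)
    have "v \<longlonglongrightarrow> 0"
    proof (rule Lim_null_comparison[OF always_eventually])
      show "(\<lambda>n. norm y * (1/2) ^ n) \<longlonglongrightarrow> 0"
        by (intro tendsto_mult_right_zero LIMSEQ_power_zero) simp
    qed (use v_le in auto)
    then have "(\<lambda>n. y - v n) \<longlonglongrightarrow> y"
      using tendsto_diff[OF tendsto_const, of v 0 sequentially y] by simp
    moreover have "(\<lambda>n. T *\<^sub>V (\<Sum>k<n. g (v k))) \<longlonglongrightarrow> T *\<^sub>V (\<Sum>n. g (v n))"
      by (intro bounded_linear.tendsto[OF bounded_linear_cblinfun] summable_LIMSEQ s)
    ultimately have "T *\<^sub>V (\<Sum>n. g (v n)) = T *\<^sub>V x0"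
      unfolding partial y_def[symmetric] by (rule LIMSEQ_unique[rotated])
    then have "x0 = (\<Sum>n. g (v n))"
      using inj by (simp add: inj_eq)
    then have "norm x0 \<le> (\<Sum>n. norm (g (v n)))"
      using summable_norm[OF sn] by simp
    also have "\<dots> \<le> (\<Sum>n. K * norm y * (1/2) ^ n)"
      by (rule suminf_le[OF le sn sums_summable[OF gs]])
    also have "\<dots> = K * norm y * 2"
      using gs by (rule sums_unique[symmetric])
    finally show ?thesis by (simp add: y_def)
  qed
  \<comment> \<open>\<open>K\<close> may be zero, and the extra 1 permits the division.\<close>
  then have "norm x \<le> (2 * K + 1) * norm (T *\<^sub>V x)" for x
    by (rule order_trans) (simp add: mult_right_mono)
  then have "1 / (2 * K + 1) * norm x \<le> norm (T *\<^sub>V x)" for x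
    using \<open>K \<ge> 0\<close> by (simp add: divide_le_eq mult.commute)
  moreover have "1 / (2 * K + 1) > 0" using \<open>K \<ge> 0\<close> by simp
  ultimately show ?thesis
    unfolding lower_bounded_def by blast
qed

lemma bounded_below_op_iff: "bounded_below_op T \<longleftrightarrow> lower_bounded T"
  unfolding bounded_below_op_def
  using lower_bounded_inj lower_bounded_closed_range closed_range_inj_lower_bounded by blast

section \<open>Invertible operators and their perturbations\<close>

lemma invertible_op_iff: "invertible_op T \<longleftrightarrow> lower_bounded T \<and> surj (cblinfun_apply T)"
proof
  assume "invertible_op T"
  then obtain S where "S o\<^sub>C\<^sub>L T = id_cblinfun" "T o\<^sub>C\<^sub>L S = id_cblinfun"
    by (auto simp: invertible_op_def)
  then have S: "S *\<^sub>V T *\<^sub>V x = x" "T *\<^sub>V S *\<^sub>V x = x" for x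
    by (metis cblinfun_compose.rep_eq id_cblinfun.rep_eq)+
  have "1 / (norm S + 1) * norm x \<le> norm (T *\<^sub>V x)" for x
  proof -
    have "norm x \<le> norm S * norm (T *\<^sub>V x)"
      using norm_cblinfun[of S "T *\<^sub>V x"] S by simp
    also have "\<dots> \<le> (norm S + 1) * norm (T *\<^sub>V x)"
      by (simp add: mult_right_mono)
    finally show ?thesis
      by (simp add: divide_le_eq mult.commute add_nonneg_pos)
  qed
  moreover have "1 / (norm S + 1) > 0"
    by (simp add: add_nonneg_pos)
  ultimately show "lower_bounded T \<and> surj (cblinfun_apply T)"
    unfolding lower_bounded_def using S(2) surjI by blast
next
  assume T: "lower_bounded T \<and> surj (cblinfun_apply T)"
  then obtain c where c: "c > 0" "\<And>x. c * norm x \<le> norm (T *\<^sub>V x)"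
    by (auto simp: lower_bounded_def)
  have inj: "inj (cblinfun_apply T)"
    using T lower_bounded_inj by blast
  define S where "S = inv (cblinfun_apply T)"
  have TS: "T *\<^sub>V S y = y" for y
    using T by (simp add: S_def surj_f_inv_f)
  have "clinear S"
    unfolding clinear_def by (intro conjI allI; rule injD[OF inj]; simp add: TS)
  moreover have "norm (S y) \<le> (1 / c) * norm y" for y
    using c(2)[of "S y"] c(1) by (simp add: TS field_simps)
  ultimately obtain F where "cblinfun_apply F = S"
    using c(1) cblinfun_of_clinear[of S "1 / c"] by auto
  then have "F o\<^sub>C\<^sub>L T = id_cblinfun" "T o\<^sub>C\<^sub>L F = id_cblinfun"
    using inj by (simp_all add: cblinfun_eqI TS) (simp add: cblinfun_eqI S_def)
  then show "invertible_op T"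
    by (auto simp: invertible_op_def)
qed

text \<open>Solving for \<open>y\<close> means finding a fixed point of
  \<open>x \<mapsto> S (y - D x)\<close> with a right inverse \<open>S\<close> of \<open>T\<close>.
  The lower bound makes \<open>S\<close> Lipschitz with constant \<open>1 / c\<close>, so this map
  is a contraction.\<close>

lemma surj_perturbation:
  fixes T D :: "'a::complex_banach \<Rightarrow>\<^sub>C\<^sub>L 'a"
  assumes surj: "surj (cblinfun_apply T)" and c: "\<And>x. c * norm x \<le> norm (T *\<^sub>V x)" and "norm D < c"
  shows "invertible_op (T + D)"
proof -
  have "c > 0" using \<open>norm D < c\<close> norm_ge_zero[of D] by linarith
  define S where "S = inv (cblinfun_apply T)"
  have TS: "T *\<^sub>V S y = y" for y
    using surj by (simp add: S_def surj_f_inv_f)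
  have "\<exists>x. (T + D) *\<^sub>V x = y" for y
  proof -
    have "\<exists>!x. S (y - D *\<^sub>V x) = x"
    proof (rule banach_fix_type[of "norm D / c"])
      show "\<forall>x x'. dist (S (y - D *\<^sub>V x)) (S (y - D *\<^sub>V x')) \<le> norm D / c * dist x x'"
      proof (intro allI)
        fix x x'
        have "c * norm (S (y - D *\<^sub>V x) - S (y - D *\<^sub>V x')) \<le> norm (D *\<^sub>V (x' - x))"
          using c[of "S (y - D *\<^sub>V x) - S (y - D *\<^sub>V x')"] by (simp add: TS)
        also have "\<dots> \<le> norm D * norm (x - x')"
          using norm_cblinfun[of D "x' - x"] by (simp add: norm_minus_commute)
        finally show "dist (S (y - D *\<^sub>V x)) (S (y - D *\<^sub>V x')) \<le> norm D / c * dist x x'"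
          using \<open>c > 0\<close> by (simp add: dist_norm field_simps)
      qed
    qed (use \<open>norm D < c\<close> \<open>c > 0\<close> in simp_all)
    then obtain x where "S (y - D *\<^sub>V x) = x" by blast
    then have "T *\<^sub>V x = y - D *\<^sub>V x"
      using TS[of "y - D *\<^sub>V x"] by simp
    then show ?thesis
      by (intro exI[of _ x]) simp
  qed
  then have "surj (cblinfun_apply (T + D))"
    unfolding surj_def by metis
  moreover have "(c - norm D) * norm x \<le> norm ((T + D) *\<^sub>V x)" for x
    using c[of x] norm_cblinfun[of D x] norm_triangle_ineq2[of "T *\<^sub>V x" "- (D *\<^sub>V x)"]
    by (simp add: left_diff_distrib)
  ultimately show ?thesis
    using \<open>norm D < c\<close> unfolding invertible_op_iff lower_bounded_def
    by (intro conjI exI[of _ "c - norm D"]) auto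
qed

lemma norm_scaleC_id_le: "norm (z *\<^sub>C (id_cblinfun :: 'a::complex_normed_vector \<Rightarrow>\<^sub>C\<^sub>L 'a)) \<le> cmod z"
  by (rule norm_cblinfun_bound) (simp_all add: norm_scaleC)

text \<open>The radius of stability depends on \<open>w\<close> only through the lower bound
  \<open>c\<close>; \<open>boundary_spectrum\<close> relies on this uniformity.\<close>

lemma invertible_op_shift:
  fixes T :: "'a::complex_banach \<Rightarrow>\<^sub>C\<^sub>L 'a"
  assumes "invertible_op (T - w *\<^sub>C id_cblinfun)"
    and "\<And>x. c * norm x \<le> norm ((T - w *\<^sub>C id_cblinfun) *\<^sub>V x)" and "cmod (w - z) < c"
  shows "invertible_op (T - z *\<^sub>C id_cblinfun)"
proof -
  have "norm ((w - z) *\<^sub>C (id_cblinfun :: 'a \<Rightarrow>\<^sub>C\<^sub>L 'a)) < c"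
    using norm_scaleC_id_le assms(3) by (rule le_less_trans)
  with assms(1,2) have "invertible_op (T - w *\<^sub>C id_cblinfun + (w - z) *\<^sub>C id_cblinfun)"
    by (intro surj_perturbation) (auto simp: invertible_op_iff)
  then show ?thesis
    by (simp add: complex_vector.scale_left_diff_distrib)
qed

section \<open>The spectrum and the approximate point spectrum\<close>

lemma spectrum_iff: "z \<in> spectrum T \<longleftrightarrow> \<not> invertible_op (T - z *\<^sub>C id_cblinfun)"
  by (simp add: spectrum_def)

lemma approx_spectrum_iff: "z \<in> approx_spectrum T \<longleftrightarrow> \<not> lower_bounded (T - z *\<^sub>C id_cblinfun)"
  by (simp add: approx_spectrum_def bounded_below_op_iff)

lemma approx_spectrum_subset_spectrum: "approx_spectrum T \<subseteq> spectrum T"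
  by (auto simp: approx_spectrum_iff spectrum_iff invertible_op_iff)

lemma closed_spectrum: "closed (spectrum T)"
proof -
  have "open (- spectrum T)"
    unfolding open_dist
  proof
    fix w assume "w \<in> - spectrum T"
    then have inv: "invertible_op (T - w *\<^sub>C id_cblinfun)"
      by (simp add: spectrum_iff)
    then obtain c where c: "c > 0" "\<And>x. c * norm x \<le> norm ((T - w *\<^sub>C id_cblinfun) *\<^sub>V x)"
      by (auto simp: invertible_op_iff lower_bounded_def)
    with inv show "\<exists>e>0. \<forall>z. dist z w < e \<longrightarrow> z \<in> - spectrum T"
      using invertible_op_shift[OF inv c(2)]
      by (intro exI[of _ c]) (auto simp: spectrum_iff dist_norm norm_minus_commute)
  qed
  then show ?thesis by (simp add: closed_def)
qed

lemma compact_spectrum: "compact (spectrum T)"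
proof -
  have "invertible_op (T - z *\<^sub>C id_cblinfun)" if "norm T < cmod z" for z
  proof -
    have "z \<noteq> 0" using that by auto
    have "surj (cblinfun_apply ((- z) *\<^sub>C (id_cblinfun :: 'a \<Rightarrow>\<^sub>C\<^sub>L 'a)))"
      by (rule surjI[of _ "\<lambda>x. inverse (- z) *\<^sub>C x"]) (use \<open>z \<noteq> 0\<close> in \<open>simp add: scaleC_scaleC\<close>)
    then have "invertible_op ((- z) *\<^sub>C id_cblinfun + T)"
      by (rule surj_perturbation[where c = "cmod z"]) (use that in \<open>simp_all add: norm_scaleC\<close>)
    then show ?thesis by simp
  qed
  then have "spectrum T \<subseteq> cball 0 (norm T)"
    by (auto simp: spectrum_iff not_less[symmetric])
  then show ?thesis
    using closed_spectrum bounded_subset bounded_cball compact_eq_bounded_closed by blast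
qed

text \<open>A lower bound at \<open>z\<close> persists at nearby points outside the spectrum, and
  invertibility there then spreads over a disc that reaches back to \<open>z\<close>.\<close>

lemma boundary_spectrum:
  assumes "z \<in> spectrum T" "z \<in> closure (- spectrum T)"
  shows "z \<in> approx_spectrum T"
proof (rule ccontr)
  assume "z \<notin> approx_spectrum T"
  then obtain c where c: "c > 0" "\<And>x. c * norm x \<le> norm ((T - z *\<^sub>C id_cblinfun) *\<^sub>V x)"
    by (auto simp: approx_spectrum_iff lower_bounded_def)
  \<comment> \<open>At this distance half of the lower bound survives at \<open>w\<close>, and the
    resulting radius \<open>c / 2\<close> still covers \<open>z\<close>.\<close>
  obtain w where w: "w \<notin> spectrum T" "cmod (w - z) < c / 2"
    using assms(2) c(1) unfolding closure_approachable dist_norm by (metis ComplD half_gt_zero)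
  have "(c / 2) * norm x \<le> norm ((T - w *\<^sub>C id_cblinfun) *\<^sub>V x)" for x
  proof -
    have eq: "(T - w *\<^sub>C id_cblinfun) *\<^sub>V x = (T - z *\<^sub>C id_cblinfun) *\<^sub>V x - (w - z) *\<^sub>C x"
      by (simp add: complex_vector.scale_left_diff_distrib)
    have "norm ((w - z) *\<^sub>C x) \<le> (c / 2) * norm x"
      unfolding norm_scaleC using w by (intro mult_right_mono) auto
    then show ?thesis
      using c(2)[of x] norm_triangle_ineq2[of "(T - z *\<^sub>C id_cblinfun) *\<^sub>V x" "(w - z) *\<^sub>C x"]
      unfolding eq by simp
  qed
  then have "invertible_op (T - z *\<^sub>C id_cblinfun)"
    using invertible_op_shift[of T w "c / 2" z] w by (simp add: spectrum_iff)
  with assms(1) show False by (simp add: spectrum_iff)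
qed

section \<open>Adjoints\<close>

lemma banach_adjoint_shift:
  "banach_adjoint T - z *\<^sub>C id_cblinfun = banach_adjoint (T - z *\<^sub>C id_cblinfun)"
  by (intro cblinfun_eqI) simp

text \<open>A preimage of \<open>f\<close> is an extension of \<open>f\<close> along
  \<open>T\<close>; the lower bound is exactly the domination that Hahn-Banach requires.\<close>

lemma surj_adjoint:
  assumes "lower_bounded T"
  shows "surj (cblinfun_apply (banach_adjoint T))"
proof -
  obtain c where c: "c > 0" "\<And>x. c * norm x \<le> norm (T *\<^sub>V x)"
    using assms by (auto simp: lower_bounded_def)
  have "\<exists>g. banach_adjoint T *\<^sub>V g = f" for f
  proof -
    have le: "cmod (f *\<^sub>V x) \<le> (norm f / c) * norm (T *\<^sub>V x)" for x
    proof -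
      have "cmod (f *\<^sub>V x) \<le> (norm f / c) * (c * norm x)"
        using norm_cblinfun[of f x] c(1) by simp
      also have "\<dots> \<le> (norm f / c) * norm (T *\<^sub>V x)"
        using c by (intro mult_left_mono) auto
      finally show ?thesis .
    qed
    obtain \<psi> where \<psi>: "clinear \<psi>" "\<And>w. cmod (\<psi> w) \<le> (norm f / c) * norm w"
        "\<And>x. \<psi> (T *\<^sub>V x) = f *\<^sub>V x"
      using hahn_banach_complex[OF cseminorm_scale[OF cseminorm_norm]
          complex_vector.subspace_UNIV clinear_cblinfun[of T] clinear_cblinfun[of f] le]
        c(1) by (metis UNIV_I divide_nonneg_pos norm_ge_zero)
    then obtain g where "cblinfun_apply g = \<psi>"
      using cblinfun_of_clinear[of \<psi> "norm f / c"] c(1) by (metis divide_nonneg_pos norm_ge_zero)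
    with \<psi>(3) show ?thesis
      by (intro exI[of _ g] cblinfun_eqI) simp
  qed
  then show ?thesis
    unfolding surj_def by metis
qed

text \<open>A nonzero functional vanishing on a proper closed range would lie in the kernel of the
  adjoint.\<close>

lemma surj_of_adjoint_inj:
  fixes T :: "'a::complex_normed_vector \<Rightarrow>\<^sub>C\<^sub>L 'b::complex_normed_vector"
  assumes "closed (range (cblinfun_apply T))" "inj (cblinfun_apply (banach_adjoint T))"
  shows "surj (cblinfun_apply T)"
proof (rule ccontr)
  assume "\<not> surj (cblinfun_apply T)"
  then obtain y where "y \<notin> range (cblinfun_apply T)" by blast
  moreover have "complex_vector.subspace (range (cblinfun_apply T))"
    unfolding complex_vector.subspace_def
    by (auto simp flip: cblinfun_linear intro: range_eqI[of _ _ 0])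
  ultimately obtain g :: "'b dual" where g: "g \<noteq> 0" "\<And>x. x \<in> range (cblinfun_apply T) \<Longrightarrow> g *\<^sub>V x = 0"
    using dual_separation[OF _ assms(1), of y] by blast
  then have "banach_adjoint T *\<^sub>V g = banach_adjoint T *\<^sub>V 0"
    by (intro cblinfun_eqI) simp
  with g(1) assms(2) show False
    by (blast dest: injD)
qed

text \<open>Write a norming functional of \<open>x\<close> as the adjoint applied to some
  \<open>g\<close>. Then \<open>norm x\<close> is \<open>cmod (g (T x))\<close>, and the lower bound
  of the adjoint controls \<open>norm g\<close>.\<close>

lemma lower_bounded_of_adjoint:
  fixes T :: "'a::complex_normed_vector \<Rightarrow>\<^sub>C\<^sub>L 'b::complex_normed_vector"
  assumes "lower_bounded (banach_adjoint T)" "surj (cblinfun_apply (banach_adjoint T))"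
  shows "lower_bounded T"
proof -
  obtain c where c: "c > 0" "\<And>g. c * norm g \<le> norm (banach_adjoint T *\<^sub>V g)"
    using assms(1) by (auto simp: lower_bounded_def)
  have "c * norm x \<le> norm (T *\<^sub>V x)" for x
  proof -
    obtain f :: "'a dual" where f: "norm f \<le> 1" "f *\<^sub>V x = norm x"
      using dual_norming by blast
    obtain g where g: "f = banach_adjoint T *\<^sub>V g"
      using assms(2) by blast
    have "norm x = cmod (g *\<^sub>V T *\<^sub>V x)"
      using f(2) unfolding g by (metis abs_norm_cancel banach_adjoint.rep_eq cblinfun_compose.rep_eq norm_of_real)
    also have "\<dots> \<le> norm g * norm (T *\<^sub>V x)"
      by (rule norm_cblinfun)
    finally have "c * norm x \<le> (c * norm g) * norm (T *\<^sub>V x)"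
      using c(1) by (simp add: mult.assoc)
    also have "\<dots> \<le> 1 * norm (T *\<^sub>V x)"
      using c(2)[of g] f(1) g by (intro mult_right_mono) auto
    finally show ?thesis by simp
  qed
  with c(1) show ?thesis
    by (auto simp: lower_bounded_def)
qed

lemma invertible_adjoint_iff: "invertible_op (banach_adjoint T) \<longleftrightarrow> invertible_op T"
proof
  assume *: "invertible_op (banach_adjoint T)"
  then have adj: "lower_bounded (banach_adjoint T)" "surj (cblinfun_apply (banach_adjoint T))"
    by (simp_all add: invertible_op_iff)
  then have "lower_bounded T"
    by (rule lower_bounded_of_adjoint)
  moreover from this have "surj (cblinfun_apply T)"
    by (intro surj_of_adjoint_inj lower_bounded_closed_range lower_bounded_inj adj)
  ultimately show "invertible_op T"
    by (simp add: invertible_op_iff)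
next
  assume "invertible_op T"
  then obtain S where S: "S o\<^sub>C\<^sub>L T = id_cblinfun" "T o\<^sub>C\<^sub>L S = id_cblinfun"
    by (auto simp: invertible_op_def)
  have "S *\<^sub>V T *\<^sub>V x = x" "T *\<^sub>V S *\<^sub>V x = x" for x
    using S by (metis cblinfun_compose.rep_eq id_cblinfun.rep_eq)+
  then have "banach_adjoint S o\<^sub>C\<^sub>L banach_adjoint T = id_cblinfun"
      "banach_adjoint T o\<^sub>C\<^sub>L banach_adjoint S = id_cblinfun"
    by (auto intro!: cblinfun_eqI)
  then show "invertible_op (banach_adjoint T)"
    by (auto simp: invertible_op_def)
qed

lemma spectrum_adjoint: "spectrum (banach_adjoint T) = spectrum T"
  by (simp add: spectrum_def banach_adjoint_shift invertible_adjoint_iff)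

section \<open>Seminorms without approximate eigenvalues vanish\<close>

text \<open>The setting is that of the proof that a bounded operator has an approximate eigenvalue,
  for a seminorm and without completeness. \<open>c\<close> does not depend on \<open>z\<close>;
  \<open>seminorm_eq_0_of_lower_bounds\<close> removes this restriction.\<close>

locale uniformly_lower_bounded =
  fixes p :: "'v::complex_normed_vector \<Rightarrow> real" and N :: "'v set" and T :: "'v \<Rightarrow> 'v"
    and M c :: real
  assumes p: "cseminorm p" and N: "complex_vector.subspace N" and T: "clinear T"
    and TN: "x \<in> N \<Longrightarrow> T x \<in> N" and M: "x \<in> N \<Longrightarrow> p (T x) \<le> M * p x" and M0: "M \<ge> 0"
    and c0: "c > 0" and lb: "x \<in> N \<Longrightarrow> c * p x \<le> p (T x - z *\<^sub>C x)"
begin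

section \<open>Density of the ranges of \<open>T - z\<close>\<close>

lemma N_closed:
  "0 \<in> N" "x \<in> N \<Longrightarrow> y \<in> N \<Longrightarrow> x + y \<in> N" "x \<in> N \<Longrightarrow> a *\<^sub>C x \<in> N"
  "x \<in> N \<Longrightarrow> y \<in> N \<Longrightarrow> x - y \<in> N"
  using N complex_vector.subspace_diff[OF N] by (auto simp: complex_vector.subspace_def)

lemma clinear_shift: "clinear (\<lambda>x. T x - z *\<^sub>C x)"
  unfolding clinear_def
  by (simp add: clinearD[OF T] scaleC_add_right complex_vector.scale_right_diff_distrib
      complex_vector.scale_left_commute algebra_simps)

text \<open>Density with respect to \<open>p\<close> replaces surjectivity, which lower bounds
  cannot give without completeness.\<close>

definition dense_range :: "complex \<Rightarrow> bool"
  where "dense_range z \<longleftrightarrow> (\<forall>x\<in>N. \<forall>e>0. \<exists>y\<in>N. p (T y - z *\<^sub>C y - x) < e)"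

text \<open>The error is again in \<open>N\<close>, so the step can be repeated on it and the errors
  decay geometrically.\<close>

lemma dense_rangeI:
  assumes q: "0 \<le> q" "q < 1"
    and step: "\<And>x. x \<in> N \<Longrightarrow> \<exists>y\<in>N. p (T y - z *\<^sub>C y - x) \<le> q * p x"
  shows "dense_range z"
  unfolding dense_range_def
proof (intro ballI allI impI)
  fix x and e :: real assume x: "x \<in> N" and "e > 0"
  have iter: "\<exists>y\<in>N. p (T y - z *\<^sub>C y - x) \<le> q ^ n * p x" for n
  proof (induction n)
    case 0
    show ?case
      using N_closed by (intro bexI[of _ 0]) (simp_all add: clinearD[OF T] cseminormD[OF p])
  next
    case (Suc n)
    then obtain y where y: "y \<in> N" "p (T y - z *\<^sub>C y - x) \<le> q ^ n * p x" by blast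
    define r where "r = x - (T y - z *\<^sub>C y)"
    have "r \<in> N" unfolding r_def using x y TN N_closed by auto
    then obtain y' where y': "y' \<in> N" "p (T y' - z *\<^sub>C y' - r) \<le> q * p r"
      using step by blast
    have "T (y + y') - z *\<^sub>C (y + y') - x = T y' - z *\<^sub>C y' - r"
      by (simp add: r_def clinearD[OF clinear_shift] clinearD[OF T] scaleC_add_right)
    moreover have "p r \<le> q ^ n * p x"
      using y(2) cseminormD(7)[OF p, of x "T y - z *\<^sub>C y"] by (simp add: r_def)
    ultimately have "p (T (y + y') - z *\<^sub>C (y + y') - x) \<le> q * (q ^ n * p x)"
      using y'(2) q(1) by (smt (verit) mult_left_mono)
    with y(1) y'(1) show ?case
      using N_closed by (intro bexI[of _ "y + y'"]) (auto simp: mult.assoc)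
  qed
  have "(\<lambda>n. q ^ n * p x) \<longlonglongrightarrow> 0"
    using q by (intro tendsto_mult_left_zero LIMSEQ_power_zero) simp
  then have "eventually (\<lambda>n. q ^ n * p x < e) sequentially"
    using \<open>e > 0\<close> by (rule order_tendstoD)
  then obtain n where "q ^ n * p x < e"
    by (auto simp: eventually_sequentially)
  with iter[of n] show "\<exists>y\<in>N. p (T y - z *\<^sub>C y - x) < e"
    by (meson le_less_trans)
qed

lemma dense_range_large:
  assumes "M < cmod z"
  shows "dense_range z"
proof (rule dense_rangeI[of "M / cmod z"])
  have "z \<noteq> 0" using assms M0 by auto
  fix x assume x: "x \<in> N"
  \<comment> \<open>This is the first term of the Neumann series for the inverse of
    \<open>T - z\<close>.\<close>
  define y where "y = - (inverse z *\<^sub>C x)"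
  have "T y - z *\<^sub>C y - x = - (inverse z *\<^sub>C T x)"
    using \<open>z \<noteq> 0\<close> by (simp add: y_def clinearD[OF T] scaleC_scaleC)
  then have "p (T y - z *\<^sub>C y - x) = p (T x) / cmod z"
    by (simp add: cseminormD[OF p] norm_inverse divide_inverse_commute)
  also have "\<dots> \<le> M / cmod z * p x"
    using M[OF x] by (simp add: divide_right_mono)
  finally show "\<exists>y\<in>N. p (T y - z *\<^sub>C y - x) \<le> M / cmod z * p x"
    using N_closed(3)[OF x, of "- inverse z"] by (intro bexI[of _ y]) (auto simp: y_def)
qed (use assms M0 in \<open>auto simp: divide_less_eq\<close>)

lemma dense_range_step:
  assumes z: "dense_range z" and w: "cmod (w - z) \<le> c / 4"
  shows "dense_range w"
proof (rule dense_rangeI[of "3 / 4"])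
  fix x assume x: "x \<in> N"
  show "\<exists>y\<in>N. p (T y - w *\<^sub>C y - x) \<le> 3 / 4 * p x"
  \<comment> \<open>For \<open>p x > 0\<close>, solving at \<open>z\<close> up to
    \<open>p x / 4\<close> gives \<open>c * p y \<le> 5 / 4 * p x\<close>. Passing to
    \<open>w\<close> adds at most a quarter of that, in total \<open>9 / 16 * p x\<close>. For
    \<open>p x = 0\<close> the strict bound \<open>p x / 4\<close> is out of reach, but
    \<open>y = 0\<close> will do.\<close>
  proof (cases "p x = 0")
    case True
    then show ?thesis
      using N_closed(1) by (intro bexI[of _ 0]) (simp_all add: clinearD[OF T] cseminormD[OF p])
  next
    case False
    then have "p x > 0" using cseminormD(5)[OF p, of x] by simp
    then obtain y where y: "y \<in> N" "p (T y - z *\<^sub>C y - x) < p x / 4"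
      using z x unfolding dense_range_def by (metis divide_pos_pos zero_less_numeral)
    have "c * p y \<le> p (T y - z *\<^sub>C y)"
      by (rule lb[OF y(1)])
    also have "\<dots> \<le> p (T y - z *\<^sub>C y - x) + p x"
      using cseminormD(1)[OF p, of "T y - z *\<^sub>C y - x" x] by simp
    finally have cy: "c * p y \<le> 5 / 4 * p x"
      using y(2) by simp
    have "T y - w *\<^sub>C y - x = (T y - z *\<^sub>C y - x) - (w - z) *\<^sub>C y"
      by (simp add: complex_vector.scale_left_diff_distrib)
    then have "p (T y - w *\<^sub>C y - x) \<le> p (T y - z *\<^sub>C y - x) + cmod (w - z) * p y"
      by (metis cseminormD(6)[OF p] cseminormD(2)[OF p])
    also have "cmod (w - z) * p y \<le> c / 4 * p y"
      using w cseminormD(5)[OF p] by (intro mult_right_mono) auto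
    finally have "p (T y - w *\<^sub>C y - x) \<le> 3 / 4 * p x"
      using y(2) cy \<open>p x > 0\<close> by simp
    with y(1) show ?thesis by blast
  qed
qed auto

text \<open>Far to the right of \<open>z\<close> density is known, and steps of the fixed length
  \<open>c / 4\<close> lead back to \<open>z\<close>.\<close>

lemma dense_range: "dense_range z"
proof -
  define d where "d = c / 4"
  have "d > 0" using c0 by (simp add: d_def)
  have walk: "dense_range (z + of_real (of_nat n * d)) \<Longrightarrow> dense_range z" for n
  proof (induction n)
    case (Suc n)
    have "cmod ((z + of_real (of_nat n * d)) - (z + of_real (of_nat (Suc n) * d))) = d"
    proof -
      have "(z + of_real (of_nat n * d)) - (z + of_real (of_nat (Suc n) * d)) = - of_real d"
        by (simp add: algebra_simps)
      then show ?thesis using \<open>d > 0\<close> by (metis abs_of_pos norm_minus_cancel norm_of_real)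
    qed
    then have "dense_range (z + of_real (of_nat n * d))"
      by (intro dense_range_step[OF Suc.prems]) (simp add: d_def)
    then show ?case by (rule Suc.IH)
  qed simp
  obtain n where n: "M + cmod z < of_nat n * d"
    using reals_Archimedean3[OF \<open>d > 0\<close>] by blast
  have "of_nat n * d \<le> cmod (z + of_real (of_nat n * d)) + cmod z"
    using norm_triangle_ineq4[of "z + of_real (of_nat n * d)" z] \<open>d > 0\<close>
    by (simp add: norm_mult)
  with n have "M < cmod (z + of_real (of_nat n * d))" by linarith
  then show ?thesis
    by (rule walk[OF dense_range_large])
qed

text \<open>The resolvent of \<open>T\<close> itself need not exist, but the Hahn-Banach theorem provides the resolvent
  of the adjoint of \<open>T\<close>, acting on the \<open>p\<close>-bounded functionals; density of the ranges makes
  it single-valued on \<open>N\<close>.\<close>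

definition resolves :: "complex \<Rightarrow> real \<Rightarrow> ('v \<Rightarrow> complex) \<Rightarrow> ('v \<Rightarrow> complex) \<Rightarrow> bool"
  where "resolves z K \<phi> \<psi> \<longleftrightarrow> clinear \<psi> \<and> (\<forall>x. cmod (\<psi> x) \<le> K / c * p x) \<and>
    (\<forall>x\<in>N. \<psi> (T x - z *\<^sub>C x) = \<phi> x)"

text \<open>The functional is extended along \<open>T - z\<close>, whose lower bound on
  \<open>N\<close> costs a factor \<open>1 / c\<close>.\<close>

lemma resolves_exists:
  assumes "clinear \<phi>" "K \<ge> 0" "\<And>x. cmod (\<phi> x) \<le> K * p x"
  shows "\<exists>\<psi>. resolves z K \<phi> \<psi>"
proof -
  have "cmod (\<phi> x) \<le> K / c * p (T x - z *\<^sub>C x)" if "x \<in> N" for x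
  proof -
    have "cmod (\<phi> x) \<le> K / c * (c * p x)"
      using assms(3)[of x] c0 by simp
    also have "\<dots> \<le> K / c * p (T x - z *\<^sub>C x)"
      using lb[OF that] c0 assms(2) by (intro mult_left_mono) auto
    finally show ?thesis .
  qed
  moreover have "cseminorm (\<lambda>x. K / c * p x)"
    using assms(2) c0 by (intro cseminorm_scale p) simp
  ultimately obtain \<psi> where "clinear \<psi>" "\<And>w. cmod (\<psi> w) \<le> K / c * p w"
      "\<And>x. x \<in> N \<Longrightarrow> \<psi> (T x - z *\<^sub>C x) = \<phi> x"
    using hahn_banach_complex[OF _ N clinear_shift assms(1)] by metis
  then show ?thesis
    by (auto simp: resolves_def)
qed

text \<open>The first resolvent identity. The difference \<open>d\<close> of the two sides vanishes
  on the range of \<open>T - z\<close> and is bounded by a multiple of \<open>p\<close>, so density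
  makes it vanish on \<open>N\<close>.\<close>

lemma resolves_identity:
  assumes z: "resolves z K \<phi> \<psi>" and w: "resolves w K \<phi> \<psi>'" and zw: "resolves z (K / c) \<psi>' \<xi>"
    and x: "x \<in> N"
  shows "\<psi> x = \<psi>' x + (z - w) * \<xi> x"
proof -
  define d where "d x = \<psi> x - \<psi>' x - (z - w) * \<xi> x" for x
  have lin: "clinear \<psi>" "clinear \<psi>'" "clinear \<xi>"
    using z w zw by (auto simp: resolves_def)
  have d_diff: "d (x - y) = d x - d y" for x y
    by (simp add: d_def clinearD[OF lin(1)] clinearD[OF lin(2)] clinearD[OF lin(3)] algebra_simps)
  have "d (T y - z *\<^sub>C y) = 0" if "y \<in> N" for y
  proof -
    have "\<psi>' (T y - z *\<^sub>C y) = \<psi>' (T y - w *\<^sub>C y) - (z - w) * \<psi>' y"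
      by (simp add: clinearD[OF lin(2)] scaleC_complex_def algebra_simps)
    then show ?thesis
      using that z w zw by (simp add: d_def resolves_def)
  qed
  define B where "B = K / c + K / c + cmod (z - w) * (K / c / c)"
  have bound: "cmod (d x) \<le> B * p x" for x
  proof -
    have "cmod (d x) \<le> cmod (\<psi> x) + cmod (\<psi>' x) + cmod ((z - w) * \<xi> x)"
      unfolding d_def by (rule order_trans[OF norm_triangle_ineq4]) (simp add: norm_triangle_ineq4)
    also have "\<dots> \<le> K / c * p x + K / c * p x + cmod (z - w) * (K / c / c * p x)"
      unfolding norm_mult using z w zw
      by (intro add_mono mult_left_mono) (auto simp: resolves_def)
    finally show ?thesis
      by (simp add: B_def algebra_simps)
  qed
  have "cmod (d x) \<le> 0 + e" if "e > 0" for e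
  proof -
    \<comment> \<open>Adding 1 keeps the denominator positive when \<open>B\<close> is zero.\<close>
    have "e / (\<bar>B\<bar> + 1) > 0" using that by simp
    then obtain y where y: "y \<in> N" "p (T y - z *\<^sub>C y - x) < e / (\<bar>B\<bar> + 1)"
      using dense_range x unfolding dense_range_def by blast
    have "cmod (d x) = cmod (d (T y - z *\<^sub>C y - x))"
      using \<open>\<And>y. y \<in> N \<Longrightarrow> d (T y - z *\<^sub>C y) = 0\<close>[OF y(1)] by (simp add: d_diff)
    also have "\<dots> \<le> (\<bar>B\<bar> + 1) * p (T y - z *\<^sub>C y - x)"
      by (rule order_trans[OF bound mult_right_mono]) (use cseminormD(5)[OF p] in auto)
    also have "\<dots> \<le> e"
      using y(2) by (simp add: pos_less_divide_eq mult.commute)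
    finally show ?thesis by simp
  qed
  then have "cmod (d x) \<le> 0"
    by (rule field_le_epsilon)
  then show ?thesis
    by (simp add: d_def algebra_simps)
qed

text \<open>For a functional norming \<open>x0\<close>, the values of its resolvents at a point of
  \<open>N\<close> form an entire function that vanishes at infinity, hence is zero. The resolvent
  equation at \<open>z = 0\<close> then kills \<open>p x0\<close>.\<close>

lemma seminorm_eq_0:
  assumes x0: "x0 \<in> N"
  shows "p x0 = 0"
proof -
  obtain \<phi> where \<phi>: "clinear \<phi>" "\<And>w. cmod (\<phi> w) \<le> p w" "\<phi> x0 = p x0"
    using norming_functional[OF p] by blast
  have "\<exists>\<psi>. resolves z 1 \<phi> \<psi>" for z
    using \<phi> by (intro resolves_exists) auto
  then obtain \<psi> where \<psi>: "resolves z 1 \<phi> (\<psi> z)" for z by metis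
  have "\<psi> z x = 0" if x: "x \<in> N" for x z
  proof (rule Liouville_weak_0[of "\<lambda>z. \<psi> z x"])
    show "(\<lambda>z. \<psi> z x) holomorphic_on UNIV"
      unfolding holomorphic_on_def
    proof (rule ballI)
      fix w :: complex
      have "\<exists>\<xi>. resolves z (1 / c) (\<psi> w) \<xi>" for z
        using \<psi>[of w] c0 by (intro resolves_exists) (auto simp: resolves_def)
      then obtain \<xi> where \<xi>: "resolves z (1 / c) (\<psi> w) (\<xi> z)" for z by metis
      \<comment> \<open>\<open>\<xi> w x\<close> will be the derivative at \<open>w\<close>.
        Continuity there follows from the resolvent identity for the functional
        \<open>\<psi> w\<close>, at the price of further factors \<open>1 / c\<close>.\<close>
      have lip: "cmod (\<xi> z x - \<xi> w x) \<le> cmod (z - w) * (1 / c / c / c * p x)" for z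
      proof -
        have "\<exists>\<theta>. resolves z (1 / c / c) (\<xi> w) \<theta>"
          using \<xi>[of w] c0 by (intro resolves_exists) (auto simp: resolves_def)
        then obtain \<theta> where \<theta>: "resolves z (1 / c / c) (\<xi> w) \<theta>" ..
        have "\<xi> z x - \<xi> w x = (z - w) * \<theta> x"
          using resolves_identity[OF \<xi> \<xi> \<theta> x] by simp
        moreover have "cmod (\<theta> x) \<le> 1 / c / c / c * p x"
          using \<theta> by (simp add: resolves_def)
        ultimately show ?thesis
          by (metis norm_mult mult_left_mono norm_ge_zero)
      qed
      have "((\<lambda>z. cmod (z - w) * (1 / c / c / c * p x)) \<longlongrightarrow> 0) (at w)"
        by (rule tendsto_eq_intros | simp)+
      then have "((\<lambda>z. \<xi> z x - \<xi> w x) \<longlongrightarrow> 0) (at w)"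
        by (rule Lim_null_comparison[OF always_eventually, rotated]) (use lip in auto)
      then have "((\<lambda>z. \<xi> z x) \<longlongrightarrow> \<xi> w x) (at w)"
        by (rule LIM_zero_cancel)
      \<comment> \<open>By the resolvent identity the difference quotient is
        \<open>\<xi> z x\<close> itself.\<close>
      moreover have "eventually (\<lambda>z. \<xi> z x = (\<psi> z x - \<psi> w x) / (z - w)) (at w)"
        using eventually_neq_at_within[of w w UNIV]
      proof eventually_elim
        case (elim z)
        then show ?case
          using resolves_identity[OF \<psi>[of z] \<psi>[of w] \<xi>[of z] x] by simp
      qed
      ultimately have "((\<lambda>z. \<psi> z x) has_field_derivative \<xi> w x) (at w)"
        unfolding has_field_derivative_iff by (simp add: tendsto_cong)
      then show "(\<lambda>z. \<psi> z x) field_differentiable at w within UNIV"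
        unfolding field_differentiable_def by auto
    qed
    \<comment> \<open>The resolvent equation reads
      \<open>z * \<psi> z x = \<psi> z (T x) - \<phi> x\<close>, and \<open>C\<close> bounds its
      right side independently of \<open>z\<close>.\<close>
    define C where "C = 1 / c * p (T x) + p x"
    show "((\<lambda>z. \<psi> z x) \<longlongrightarrow> 0) at_infinity"
    proof (rule Lim_null_comparison)
      show "\<forall>\<^sub>F z in at_infinity. norm (\<psi> z x) \<le> C * norm (inverse z)"
        using eventually_not_equal_at_infinity[of 0]
      proof eventually_elim
        case (elim z)
        have lin: "clinear (\<psi> z)" and eq: "\<psi> z (T x - z *\<^sub>C x) = \<phi> x"
          and le: "cmod (\<psi> z (T x)) \<le> 1 / c * p (T x)"
          using \<psi>[of z] x by (auto simp: resolves_def)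
        have "z * \<psi> z x = \<psi> z (T x) - \<phi> x"
          using eq by (simp add: clinearD[OF lin] scaleC_complex_def algebra_simps)
        then have "cmod z * cmod (\<psi> z x) \<le> cmod (\<psi> z (T x)) + cmod (\<phi> x)"
          by (metis norm_mult norm_triangle_ineq4)
        also have "\<dots> \<le> C"
          unfolding C_def by (intro add_mono le \<phi>(2))
        finally show ?case
          using elim by (simp add: norm_inverse pos_le_divide_eq mult.commute flip: divide_inverse)
      qed
      show "((\<lambda>z. C * norm (inverse z)) \<longlongrightarrow> 0) (at_infinity :: complex filter)"
        by (intro tendsto_mult_right_zero tendsto_norm_zero tendsto_inverse_0)
    qed
  qed
  then have "\<psi> 0 (T x0) = 0"
    using TN[OF x0] by simp
  moreover have "\<psi> 0 (T x0) = \<phi> x0"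
    using \<psi>[of 0] x0 by (auto simp: resolves_def)
  ultimately show ?thesis
    using \<phi>(3) by simp
qed

end

text \<open>Compactness makes the lower bounds uniform. Half of \<open>c z\<close> survives on a
  disc around \<open>z\<close>, finitely many discs cover \<open>cball 0 (M + 1)\<close>, and
  outside it the bound on \<open>T\<close> alone gives the constant 1.\<close>

theorem seminorm_eq_0_of_lower_bounds:
  fixes p :: "'v::complex_normed_vector \<Rightarrow> real"
  assumes p: "cseminorm p" and N: "complex_vector.subspace N" and T: "clinear T"
    and TN: "\<And>x. x \<in> N \<Longrightarrow> T x \<in> N" and M: "\<And>x. x \<in> N \<Longrightarrow> p (T x) \<le> M * p x" and M0: "M \<ge> 0"
    and lb: "\<And>z. \<exists>c>0. \<forall>x\<in>N. c * p x \<le> p (T x - z *\<^sub>C x)"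
    and x0: "x0 \<in> N"
  shows "p x0 = 0"
proof -
  obtain c where c: "c z > 0" "\<And>x. x \<in> N \<Longrightarrow> c z * p x \<le> p (T x - z *\<^sub>C x)" for z
    using lb by metis
  have near: "c z / 2 * p x \<le> p (T x - w *\<^sub>C x)" if x: "x \<in> N" and w: "w \<in> ball z (c z / 2)" for x z w
  proof -
    have eq: "T x - z *\<^sub>C x = (T x - w *\<^sub>C x) + (w - z) *\<^sub>C x"
      by (simp add: complex_vector.scale_left_diff_distrib)
    have "p (T x - z *\<^sub>C x) \<le> p (T x - w *\<^sub>C x) + cmod (w - z) * p x"
      unfolding eq by (metis cseminormD(1,2)[OF p])
    moreover have "cmod (w - z) * p x \<le> c z / 2 * p x"
      using w cseminormD(5)[OF p] by (intro mult_right_mono) (auto simp: dist_norm norm_minus_commute)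
    ultimately show ?thesis
      using c(2)[OF x, of z] by simp
  qed
  have far: "1 * p x \<le> p (T x - w *\<^sub>C x)" if x: "x \<in> N" and w: "M + 1 \<le> cmod w" for x w
  proof -
    have "cmod w * p x \<le> p (T x - w *\<^sub>C x) + p (T x)"
      using cseminormD(6)[OF p, of "T x" "T x - w *\<^sub>C x"] by (simp add: cseminormD(2)[OF p])
    moreover have "(M + 1) * p x \<le> cmod w * p x"
      using w cseminormD(5)[OF p] by (intro mult_right_mono)
    ultimately show ?thesis
      using M[OF x] by (simp add: distrib_right)
  qed
  obtain Z where Z: "finite Z" "cball 0 (M + 1) \<subseteq> (\<Union>z\<in>Z. ball z (c z / 2))"
  proof (rule compactE_image[of "cball 0 (M + 1)" UNIV "\<lambda>z. ball z (c z / 2)"])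
    show "cball 0 (M + 1) \<subseteq> (\<Union>z. ball z (c z / 2))"
      using c(1) by (meson UNIV_I UN_I centre_in_ball half_gt_zero subsetI)
  qed auto
  define k where "k = Min (insert 1 ((\<lambda>z. c z / 2) ` Z))"
  have k0: "k > 0" and k1: "k \<le> 1"
    using Z(1) c(1) by (auto simp: k_def)
  have kZ: "k \<le> c z / 2" if "z \<in> Z" for z
    unfolding k_def using Z(1) that by (intro Min_le) auto
  have "k * p x \<le> p (T x - w *\<^sub>C x)" if x: "x \<in> N" for x w
  proof (cases "cmod w \<le> M + 1")
    case True
    then obtain z where z: "z \<in> Z" "w \<in> ball z (c z / 2)"
      using Z(2) by auto
    have "k * p x \<le> c z / 2 * p x"
      using kZ[OF z(1)] cseminormD(5)[OF p] by (intro mult_right_mono)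
    with near[OF x z(2)] show ?thesis by linarith
  next
    case False
    have "k * p x \<le> 1 * p x"
      using k1 cseminormD(5)[OF p] by (intro mult_right_mono)
    with far[OF x, of w] False show ?thesis by linarith
  qed
  then interpret uniformly_lower_bounded p N T M k
    using p N T TN M M0 k0 by unfold_locales auto
  show ?thesis
    by (rule seminorm_eq_0[OF x0])
qed

section \<open>Generalized derivations\<close>

lift_definition rank_one :: "'x::complex_normed_vector \<Rightarrow> 'y::complex_normed_vector dual \<Rightarrow> 'y \<Rightarrow>\<^sub>C\<^sub>L 'x"
  is "\<lambda>x f y. (f *\<^sub>V y) *\<^sub>C x"
proof (rule bounded_clinearI)
  fix x :: 'x and f :: "'y dual" and y
  show "norm ((f *\<^sub>V y) *\<^sub>C x) \<le> norm y * (norm f * norm x)"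
    using mult_right_mono[OF norm_cblinfun[of f y], of "norm x"] by (simp add: norm_scaleC mult_ac)
qed (simp_all add: scaleC_add_left scaleC_scaleC scaleC_complex_def)

lemma norm_rank_one: "norm (rank_one x f) = norm f * norm x"
proof (rule antisym)
  show "norm (rank_one x f) \<le> norm f * norm x"
    using mult_right_mono[OF norm_cblinfun[of f], of "norm x"]
    by (intro norm_cblinfun_bound) (simp_all add: rank_one.rep_eq norm_scaleC mult_ac)
  show "norm f * norm x \<le> norm (rank_one x f)"
  proof (cases "x = 0")
    case False
    have "cmod (f *\<^sub>V y) \<le> norm (rank_one x f) / norm x * norm y" for y
      using norm_cblinfun[of "rank_one x f" y] False
      by (simp add: rank_one.rep_eq norm_scaleC pos_le_divide_eq)
    then have "norm f \<le> norm (rank_one x f) / norm x"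
      by (intro norm_cblinfun_bound) simp_all
    with False show ?thesis by (simp add: pos_le_divide_eq)
  qed simp
qed

text \<open>Composing a rank one operator with \<open>B\<close> on the right applies the adjoint of
  \<open>B\<close> to its functional, which is why that adjoint governs the derivation.\<close>

lemma derivation_rank_one:
  "(generalized_derivation A B - (a - b) *\<^sub>C id_cblinfun) *\<^sub>V rank_one x f =
    rank_one ((A - a *\<^sub>C id_cblinfun) *\<^sub>V x) f - rank_one x ((banach_adjoint B - b *\<^sub>C id_cblinfun) *\<^sub>V f)"
  by (rule cblinfun_eqI)
    (simp add: rank_one.rep_eq complex_vector.scale_right_diff_distrib
      complex_vector.scale_left_diff_distrib scaleC_scaleC scaleC_complex_def algebra_simps)

lemma approx_spectrum_derivation_superset:
  assumes a: "a \<in> approx_spectrum A" and b: "b \<in> approx_spectrum (banach_adjoint B)"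
  shows "a - b \<in> approx_spectrum (generalized_derivation A B)"
proof (rule ccontr)
  assume "a - b \<notin> approx_spectrum (generalized_derivation A B)"
  then obtain c where c: "c > 0"
    "\<And>U. c * norm U \<le> norm ((generalized_derivation A B - (a - b) *\<^sub>C id_cblinfun) *\<^sub>V U)"
    by (auto simp: approx_spectrum_iff lower_bounded_def)
  \<comment> \<open>Each of the two rank one terms gets half of \<open>c\<close>, so together they
    undercut it.\<close>
  have "c / 2 > 0" using c(1) by simp
  obtain x where x: "norm x = 1" "norm ((A - a *\<^sub>C id_cblinfun) *\<^sub>V x) < c / 2"
    using a \<open>c / 2 > 0\<close> not_lower_boundedE unfolding approx_spectrum_iff by blast
  obtain f where f: "norm f = 1" "norm ((banach_adjoint B - b *\<^sub>C id_cblinfun) *\<^sub>V f) < c / 2"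
    using b \<open>c / 2 > 0\<close> not_lower_boundedE unfolding approx_spectrum_iff by blast
  have "c \<le> norm (rank_one ((A - a *\<^sub>C id_cblinfun) *\<^sub>V x) f
      - rank_one x ((banach_adjoint B - b *\<^sub>C id_cblinfun) *\<^sub>V f))"
    using c(2)[of "rank_one x f"] x(1) f(1) unfolding derivation_rank_one norm_rank_one by simp
  also have "\<dots> \<le> norm ((A - a *\<^sub>C id_cblinfun) *\<^sub>V x)
      + norm ((banach_adjoint B - b *\<^sub>C id_cblinfun) *\<^sub>V f)"
    by (rule order_trans[OF norm_triangle_ineq4])
      (simp only: norm_rank_one x(1) f(1) mult_1 mult_1_right order_refl)
  finally show False using x(2) f(2) by simp
qed

text \<open>The functional \<open>U \<mapsto> g (U y)\<close> is almost an eigenvector of the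
  adjoint of the derivation. Hence it is small on the solution of an equation with right side
  \<open>rank_one x f\<close>, on which it should take the large value \<open>g x\<close>.\<close>

lemma spectrum_derivation_superset_adjoint:
  fixes A :: "'x::complex_banach \<Rightarrow>\<^sub>C\<^sub>L 'x" and B :: "'y::complex_banach \<Rightarrow>\<^sub>C\<^sub>L 'y"
  assumes a: "a \<in> approx_spectrum (banach_adjoint A)" and b: "b \<in> approx_spectrum B"
  shows "a - b \<in> spectrum (generalized_derivation A B)"
proof (rule ccontr)
  assume "a - b \<notin> spectrum (generalized_derivation A B)"
  then obtain c where c: "c > 0"
    "\<And>U. c * norm U \<le> norm ((generalized_derivation A B - (a - b) *\<^sub>C id_cblinfun) *\<^sub>V U)"
    and surj: "surj (cblinfun_apply (generalized_derivation A B - (a - b) *\<^sub>C id_cblinfun))"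
    by (auto simp: spectrum_iff invertible_op_iff lower_bounded_def)
  \<comment> \<open>The solution satisfies \<open>c * norm U \<le> 1\<close>, so two terms of size
    \<open>c / 4 * norm U\<close> add up to at most \<open>1 / 2\<close>, which is below
    \<open>cmod (g x)\<close>.\<close>
  have "c / 4 > 0" using c(1) by simp
  obtain g where g: "norm g = 1" "norm ((banach_adjoint A - a *\<^sub>C id_cblinfun) *\<^sub>V g) < c / 4"
    using a \<open>c / 4 > 0\<close> not_lower_boundedE unfolding approx_spectrum_iff by blast
  obtain y where y: "norm y = 1" "norm ((B - b *\<^sub>C id_cblinfun) *\<^sub>V y) < c / 4"
    using b \<open>c / 4 > 0\<close> not_lower_boundedE unfolding approx_spectrum_iff by blast
  obtain x where x: "norm x = 1" "1 / 2 < cmod (g *\<^sub>V x)"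
    using norm_cblinfun_approx[of "1 / 2" g] g(1) by auto
  obtain f :: "'y dual" where f: "norm f \<le> 1" "f *\<^sub>V y = norm y"
    using dual_norming by blast
  obtain U where U: "(generalized_derivation A B - (a - b) *\<^sub>C id_cblinfun) *\<^sub>V U = rank_one x f"
    using surj by (metis surjD)
  have cU: "c * norm U \<le> 1"
    using c(2)[of U] f(1) x(1) unfolding U norm_rank_one by simp
  have "((generalized_derivation A B - (a - b) *\<^sub>C id_cblinfun) *\<^sub>V U) *\<^sub>V y = x"
    unfolding U using f(2) y(1) by (simp add: rank_one.rep_eq)
  then have "x = (A - a *\<^sub>C id_cblinfun) *\<^sub>V U *\<^sub>V y - U *\<^sub>V (B - b *\<^sub>C id_cblinfun) *\<^sub>V y"
    by (auto simp: complex_vector.scale_left_diff_distrib)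
  then have "g *\<^sub>V x = ((banach_adjoint A - a *\<^sub>C id_cblinfun) *\<^sub>V g) *\<^sub>V U *\<^sub>V y
      - g *\<^sub>V U *\<^sub>V (B - b *\<^sub>C id_cblinfun) *\<^sub>V y"
    by (metis banach_adjoint.rep_eq banach_adjoint_shift cblinfun_compose.rep_eq cblinfun_linear(6))
  then have "cmod (g *\<^sub>V x) \<le> cmod (((banach_adjoint A - a *\<^sub>C id_cblinfun) *\<^sub>V g) *\<^sub>V U *\<^sub>V y)
      + cmod (g *\<^sub>V U *\<^sub>V (B - b *\<^sub>C id_cblinfun) *\<^sub>V y)"
    by (metis norm_triangle_ineq4)
  also have "cmod (((banach_adjoint A - a *\<^sub>C id_cblinfun) *\<^sub>V g) *\<^sub>V U *\<^sub>V y) \<le> c / 4 * norm U"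
  proof -
    have "cmod (((banach_adjoint A - a *\<^sub>C id_cblinfun) *\<^sub>V g) *\<^sub>V U *\<^sub>V y)
        \<le> norm ((banach_adjoint A - a *\<^sub>C id_cblinfun) *\<^sub>V g) * norm (U *\<^sub>V y)"
      by (rule norm_cblinfun)
    also have "\<dots> \<le> c / 4 * norm U"
      using g(2) norm_cblinfun[of U y] y(1) c(1) by (intro mult_mono) auto
    finally show ?thesis .
  qed
  also have "cmod (g *\<^sub>V U *\<^sub>V (B - b *\<^sub>C id_cblinfun) *\<^sub>V y) \<le> c / 4 * norm U"
  proof -
    have "cmod (g *\<^sub>V U *\<^sub>V (B - b *\<^sub>C id_cblinfun) *\<^sub>V y)
        \<le> norm (U *\<^sub>V (B - b *\<^sub>C id_cblinfun) *\<^sub>V y)"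
      using norm_cblinfun[of g "U *\<^sub>V (B - b *\<^sub>C id_cblinfun) *\<^sub>V y"] g(1) by simp
    also have "\<dots> \<le> norm U * norm ((B - b *\<^sub>C id_cblinfun) *\<^sub>V y)"
      by (rule norm_cblinfun)
    also have "\<dots> \<le> norm U * (c / 4)"
      using y(2) by (intro mult_left_mono) auto
    finally show ?thesis by (simp add: mult.commute)
  qed
  finally show False
    using cU x(2) by simp
qed

text \<open>Moving \<open>a\<close> and \<open>b\<close> simultaneously in the real direction keeps \<open>a - b\<close>; at the last moment
  when both are still in the respective spectra, one of them is a boundary point.\<close>

lemma spectrum_derivation_superset:
  fixes A :: "'x::complex_banach \<Rightarrow>\<^sub>C\<^sub>L 'x" and B :: "'y::complex_banach \<Rightarrow>\<^sub>C\<^sub>L 'y"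
  assumes a: "a \<in> spectrum A" and b: "b \<in> spectrum B"
  shows "a - b \<in> spectrum (generalized_derivation A B)"
proof -
  have boundary_case: "a - b \<in> spectrum (generalized_derivation A B)"
    if ab: "a \<in> spectrum A" "b \<in> spectrum B"
      and bd: "a \<in> closure (- spectrum A) \<or> b \<in> closure (- spectrum B)" for a b
    using bd
  proof
    assume "a \<in> closure (- spectrum A)"
    \<comment> \<open>Lying in both approximate point spectra, \<open>a\<close> can be paired with
      \<open>b\<close> whether \<open>b\<close> is an approximate eigenvalue of \<open>B\<close> or
      of its adjoint.\<close>
    then have a: "a \<in> approx_spectrum A" "a \<in> approx_spectrum (banach_adjoint A)"
      using ab boundary_spectrum[of a A] boundary_spectrum[of a "banach_adjoint A"]
      by (auto simp: spectrum_adjoint)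
    show ?thesis
    proof (cases "b \<in> approx_spectrum B")
      case True
      then show ?thesis
        using a(2) by (rule spectrum_derivation_superset_adjoint[rotated])
    next
      case False
      \<comment> \<open>The adjoint of \<open>B - b\<close> is onto but not invertible, so it cannot
        be bounded below.\<close>
      then have "surj (cblinfun_apply (banach_adjoint (B - b *\<^sub>C id_cblinfun)))"
        by (intro surj_adjoint) (simp add: approx_spectrum_iff)
      moreover have "b \<in> spectrum (banach_adjoint B)"
        using ab by (simp add: spectrum_adjoint)
      ultimately have "b \<in> approx_spectrum (banach_adjoint B)"
        by (simp add: spectrum_iff approx_spectrum_iff invertible_op_iff banach_adjoint_shift)
      with a(1) show ?thesis
        using approx_spectrum_derivation_superset approx_spectrum_subset_spectrum by blast
    qed
  next
    assume "b \<in> closure (- spectrum B)"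
    then have b: "b \<in> approx_spectrum B" "b \<in> approx_spectrum (banach_adjoint B)"
      using ab boundary_spectrum[of b B] boundary_spectrum[of b "banach_adjoint B"]
      by (auto simp: spectrum_adjoint)
    show ?thesis
    proof (cases "a \<in> approx_spectrum A")
      case True
      then show ?thesis
        using b(2) approx_spectrum_derivation_superset approx_spectrum_subset_spectrum by blast
    next
      case False
      then have lb: "lower_bounded (A - a *\<^sub>C id_cblinfun)"
        by (simp add: approx_spectrum_iff)
      with ab have "\<not> surj (cblinfun_apply (A - a *\<^sub>C id_cblinfun))"
        by (auto simp: spectrum_iff invertible_op_iff)
      then have "\<not> lower_bounded (banach_adjoint (A - a *\<^sub>C id_cblinfun))"
        using surj_of_adjoint_inj[OF lower_bounded_closed_range[OF lb]] lower_bounded_inj by blast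
      then have "a \<in> approx_spectrum (banach_adjoint A)"
        by (simp add: approx_spectrum_iff banach_adjoint_shift)
      then show ?thesis
        using b(1) by (rule spectrum_derivation_superset_adjoint)
    qed
  qed
  define S where "S = {t. a + of_real t \<in> spectrum A \<and> b + of_real t \<in> spectrum B}"
  have "closed S"
  proof -
    have "S = (\<lambda>t. a + of_real t) -` spectrum A \<inter> (\<lambda>t. b + of_real t) -` spectrum B"
      by (auto simp: S_def)
    then show ?thesis
      by (auto intro!: closed_Int continuous_closed_vimage closed_spectrum continuous_intros)
  qed
  moreover have "bounded S"
  proof -
    obtain R where R: "\<And>z. z \<in> spectrum A \<Longrightarrow> cmod z \<le> R"
      using compact_imp_bounded[OF compact_spectrum, of A] unfolding bounded_iff by blast
    have "\<bar>t\<bar> \<le> R + cmod a" if "t \<in> S" for t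
      using R[of "a + of_real t"] norm_triangle_ineq4[of "a + of_real t" a] that by (auto simp: S_def)
    then show ?thesis unfolding bounded_iff by auto
  qed
  ultimately have "compact S" by (simp add: compact_eq_bounded_closed)
  moreover have "0 \<in> S" using a b by (simp add: S_def)
  ultimately obtain t where t: "t \<in> S" "\<And>s. s \<in> S \<Longrightarrow> s \<le> t"
    using compact_attains_sup[of S] by blast
  have "a + of_real t \<notin> interior (spectrum A) \<or> b + of_real t \<notin> interior (spectrum B)"
  proof (rule ccontr)
    assume "\<not> ?thesis"
    then obtain d e where de: "d > 0" "ball (a + of_real t) d \<subseteq> spectrum A"
        "e > 0" "ball (b + of_real t) e \<subseteq> spectrum B"
      unfolding mem_interior by blast
    define s where "s = min d e / 2"
    have s: "0 < s" "s < d" "s < e" using de by (auto simp: s_def)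
    then have "a + of_real (t + s) \<in> ball (a + of_real t) d" "b + of_real (t + s) \<in> ball (b + of_real t) e"
      by (simp_all add: dist_norm)
    then have "t + s \<in> S"
      using de by (auto simp: S_def)
    with t(2) s(1) show False by fastforce
  qed
  then have "(a + of_real t) - (b + of_real t) \<in> spectrum (generalized_derivation A B)"
    using t(1) by (intro boundary_case) (auto simp: S_def closure_complement)
  then show ?thesis by simp
qed

section \<open>The approximate point spectrum of a generalized derivation\<close>

text \<open>The library's \<open>limsup\<close> needs a complete lattice; this real-valued version is junk for sequences
  that are not bounded above.\<close>

definition limsup_norm :: "(nat \<Rightarrow> real) \<Rightarrow> real"
  where "limsup_norm s = Inf {t. 0 \<le> t \<and> eventually (\<lambda>n. s n \<le> t) sequentially}"

lemma limsup_norm_le: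
  assumes "0 \<le> t" "eventually (\<lambda>n. s n \<le> t) sequentially"
  shows "limsup_norm s \<le> t"
  unfolding limsup_norm_def by (rule cInf_lower) (use assms in \<open>auto intro!: bdd_belowI[of _ 0]\<close>)

lemma limsup_norm_ge:
  assumes "\<And>n. s n \<le> K" "\<And>t. 0 \<le> t \<Longrightarrow> eventually (\<lambda>n. s n \<le> t) sequentially \<Longrightarrow> c \<le> t"
  shows "c \<le> limsup_norm s"
  unfolding limsup_norm_def
proof (rule cInf_greatest)
  have "s n \<le> \<bar>K\<bar>" for n using assms(1)[of n] by simp
  then have "\<bar>K\<bar> \<in> {t. 0 \<le> t \<and> eventually (\<lambda>n. s n \<le> t) sequentially}"
    by simp
  then show "{t. 0 \<le> t \<and> eventually (\<lambda>n. s n \<le> t) sequentially} \<noteq> {}" by blast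
qed (use assms(2) in auto)

lemma limsup_norm_nonneg: "(\<And>n. s n \<le> K) \<Longrightarrow> 0 \<le> limsup_norm s"
  by (rule limsup_norm_ge) auto

lemma eventually_le_limsup_norm:
  assumes "\<And>n. s n \<le> K" "e > 0"
  shows "eventually (\<lambda>n. s n \<le> limsup_norm s + e) sequentially"
proof -
  have "\<not> limsup_norm s + e \<le> limsup_norm s" using assms(2) by simp
  then obtain t where "eventually (\<lambda>n. s n \<le> t) sequentially" "t < limsup_norm s + e"
    using limsup_norm_ge[of s K "limsup_norm s + e"] assms(1) by force
  then show ?thesis
    by (auto elim: eventually_mono)
qed

lemma limsup_norm_mult_le:
  assumes r: "\<And>n. r n \<le> K" and "k \<ge> 0"
    and ev: "\<And>e. e > 0 \<Longrightarrow> eventually (\<lambda>n. s n \<le> k * r n + e) sequentially"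
  shows "limsup_norm s \<le> k * limsup_norm r"
proof (rule field_le_epsilon)
  fix e :: real assume "e > 0"
  \<comment> \<open>The error enters once directly and once multiplied by \<open>k\<close>, so
    \<open>d\<close> is chosen with \<open>k * d + d = e\<close>.\<close>
  define d where "d = e / (k + 1)"
  have "d > 0" using \<open>e > 0\<close> \<open>k \<ge> 0\<close> by (simp add: d_def)
  have "k * d + d = (k + 1) * d" by (simp add: distrib_right)
  also have "\<dots> = e" using \<open>k \<ge> 0\<close> by (simp add: d_def)
  finally have "k * d + d = e" .
  have "eventually (\<lambda>n. s n \<le> k * limsup_norm r + e) sequentially"
    using ev[OF \<open>d > 0\<close>] eventually_le_limsup_norm[of r K, OF r \<open>d > 0\<close>]
  proof eventually_elim
    case (elim n)
    have "k * r n \<le> k * limsup_norm r + k * d"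
      using mult_left_mono[OF elim(2) \<open>k \<ge> 0\<close>] by (simp add: distrib_left)
    with elim(1) \<open>k * d + d = e\<close> show ?case by linarith
  qed
  then show "limsup_norm s \<le> k * limsup_norm r + e"
    using \<open>e > 0\<close> \<open>k \<ge> 0\<close> limsup_norm_nonneg[OF r] by (intro limsup_norm_le) auto
qed

lemma limsup_norm_add_le:
  assumes r: "\<And>n. r n \<le> K" and r': "\<And>n. r' n \<le> K'" and s: "\<And>n. s n \<le> r n + r' n"
  shows "limsup_norm s \<le> limsup_norm r + limsup_norm r'"
proof (rule field_le_epsilon)
  fix e :: real assume "e > 0"
  then have "e / 2 > 0" by simp
  have "eventually (\<lambda>n. s n \<le> limsup_norm r + limsup_norm r' + e) sequentially"
    using eventually_le_limsup_norm[of r K, OF r \<open>e / 2 > 0\<close>]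
      eventually_le_limsup_norm[of r' K', OF r' \<open>e / 2 > 0\<close>]
  proof eventually_elim
    case (elim n)
    then show ?case using s[of n] by (simp add: field_simps)
  qed
  then show "limsup_norm s \<le> limsup_norm r + limsup_norm r' + e"
    using \<open>e > 0\<close> limsup_norm_nonneg[OF r] limsup_norm_nonneg[OF r'] by (intro limsup_norm_le) auto
qed

section \<open>Lower bounds for left and right multiplication\<close>

lemma lower_bound_compose_left:
  assumes "\<And>x. c * norm x \<le> norm (T *\<^sub>V x)" "c > 0"
  shows "c * norm V \<le> norm (T o\<^sub>C\<^sub>L V)"
proof -
  have "norm V \<le> norm (T o\<^sub>C\<^sub>L V) / c"
  proof (rule norm_cblinfun_bound)
    fix y
    have "c * norm (V *\<^sub>V y) \<le> norm (T o\<^sub>C\<^sub>L V) * norm y"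
      using assms(1)[of "V *\<^sub>V y"] norm_cblinfun[of "T o\<^sub>C\<^sub>L V" y] by simp
    then show "norm (V *\<^sub>V y) \<le> norm (T o\<^sub>C\<^sub>L V) / c * norm y"
      using assms(2) by (simp add: field_simps)
  qed (use assms(2) in simp)
  then show ?thesis using assms(2) by (simp add: field_simps)
qed

text \<open>For a functional \<open>g\<close> norming \<open>V y\<close>, composing
  \<open>g V\<close> with \<open>S\<close> is the adjoint of \<open>S\<close> acting on
  \<open>g V\<close>, so the lower bound of the adjoint applies.\<close>

lemma lower_bound_compose_right:
  fixes S :: "'b::complex_normed_vector \<Rightarrow>\<^sub>C\<^sub>L 'b" and V :: "'b \<Rightarrow>\<^sub>C\<^sub>L 'a::complex_normed_vector"
  assumes c: "\<And>f. c * norm f \<le> norm (banach_adjoint S *\<^sub>V f)" "c > 0"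
  shows "c * norm V \<le> norm (V o\<^sub>C\<^sub>L S)"
proof -
  have "norm V \<le> norm (V o\<^sub>C\<^sub>L S) / c"
  proof (rule norm_cblinfun_bound)
    fix y
    obtain g :: "'a dual" where g: "norm g \<le> 1" "g *\<^sub>V V *\<^sub>V y = norm (V *\<^sub>V y)"
      using dual_norming by blast
    have "banach_adjoint S *\<^sub>V (g o\<^sub>C\<^sub>L V) = g o\<^sub>C\<^sub>L (V o\<^sub>C\<^sub>L S)"
      by (intro cblinfun_eqI) simp
    then have "c * norm (g o\<^sub>C\<^sub>L V) \<le> norm (g o\<^sub>C\<^sub>L (V o\<^sub>C\<^sub>L S))"
      using c(1)[of "g o\<^sub>C\<^sub>L V"] by simp
    also have "\<dots> \<le> 1 * norm (V o\<^sub>C\<^sub>L S)"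
      using g(1) by (intro order_trans[OF norm_cblinfun_compose] mult_right_mono) auto
    finally have le: "norm (g o\<^sub>C\<^sub>L V) \<le> norm (V o\<^sub>C\<^sub>L S) / c"
      using c(2) by (simp add: field_simps)
    have "norm (V *\<^sub>V y) = cmod ((g o\<^sub>C\<^sub>L V) *\<^sub>V y)"
      by (simp add: g(2))
    also have "\<dots> \<le> norm (g o\<^sub>C\<^sub>L V) * norm y"
      by (rule norm_cblinfun)
    also have "\<dots> \<le> norm (V o\<^sub>C\<^sub>L S) / c * norm y"
      using le by (intro mult_right_mono) auto
    finally show "norm (V *\<^sub>V y) \<le> norm (V o\<^sub>C\<^sub>L S) / c * norm y" .
  qed (use c(2) in simp)
  then show ?thesis using c(2) by (simp add: field_simps)
qed

text \<open>For \<open>P\<close> commuting with \<open>A\<close> and an approximate eigenvector \<open>U\<close> of the derivation at \<open>l\<close>, the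
  products \<open>A P U\<^sub>n\<close> and \<open>P U\<^sub>n (B + l)\<close> are asymptotically equal. So a lower bound for \<open>A - z\<close> and one
  for the adjoint of \<open>B - (z - l)\<close> both bound left multiplication by \<open>A - z\<close> from below in the
  seminorm \<open>limsup \<parallel>P U\<^sub>n\<parallel>\<close>. If one of them existed for every \<open>z\<close>, the seminorm would vanish.\<close>

theorem approx_spectrum_derivation_subset:
  fixes A :: "'x::complex_banach \<Rightarrow>\<^sub>C\<^sub>L 'x" and B :: "'y::complex_banach \<Rightarrow>\<^sub>C\<^sub>L 'y"
  assumes l: "l \<in> approx_spectrum (generalized_derivation A B)"
  obtains a b where "a \<in> approx_spectrum A" "b \<in> approx_spectrum (banach_adjoint B)" "l = a - b"
proof (rule ccontr)
  assume "\<not> thesis"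
  with that have disj: "z \<notin> approx_spectrum A \<or> z - l \<notin> approx_spectrum (banach_adjoint B)" for z
    by (metis diff_diff_eq2 add_diff_cancel_left')
  have "\<exists>U. norm U = 1 \<and>
      norm ((generalized_derivation A B - l *\<^sub>C id_cblinfun) *\<^sub>V U) < inverse (real (Suc n))" for n
    using l not_lower_boundedE[of _ "inverse (real (Suc n))"]
    unfolding approx_spectrum_iff by (metis inverse_positive_iff_positive of_nat_0_less_iff zero_less_Suc)
  then obtain U where U1: "norm (U n) = 1" and
    U: "norm ((generalized_derivation A B - l *\<^sub>C id_cblinfun) *\<^sub>V U n) < inverse (real (Suc n))" for n
    by metis
  define W where "W n = (generalized_derivation A B - l *\<^sub>C id_cblinfun) *\<^sub>V U n" for n
  have "W \<longlonglongrightarrow> 0"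
    using U by (intro Lim_null_comparison[OF always_eventually LIMSEQ_inverse_real_of_nat])
      (auto simp: W_def intro: less_imp_le)
  \<comment> \<open>The shifts match: \<open>z\<close> for \<open>A\<close> corresponds to
    \<open>z - l\<close> for \<open>B\<close>, up to the vanishing error \<open>W n\<close>.\<close>
  have AU: "A o\<^sub>C\<^sub>L U n - z *\<^sub>C U n = W n + U n o\<^sub>C\<^sub>L (B - (z - l) *\<^sub>C id_cblinfun)" for n z
    unfolding W_def
    by (rule cblinfun_eqI) (simp add: complex_vector.scale_left_diff_distrib algebra_simps)
  define p where "p P = limsup_norm (\<lambda>n. norm (P o\<^sub>C\<^sub>L U n))" for P :: "'x \<Rightarrow>\<^sub>C\<^sub>L 'x"
  have bd: "norm (P o\<^sub>C\<^sub>L U n) \<le> norm P" for P :: "'x \<Rightarrow>\<^sub>C\<^sub>L 'x" and n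
    using norm_cblinfun_compose[of P "U n"] by (simp add: U1)
  define N where "N = {P. A o\<^sub>C\<^sub>L P = P o\<^sub>C\<^sub>L A}"
  have "p id_cblinfun = 0"
  proof (rule seminorm_eq_0_of_lower_bounds[where N = N and T = "\<lambda>P. A o\<^sub>C\<^sub>L P" and M = "norm A"])
    show "cseminorm p"
    proof (rule cseminormI)
      show "p (P + Q) \<le> p P + p Q" for P Q
        unfolding p_def using bd
        by (rule limsup_norm_add_le) (use bd in \<open>auto simp: cblinfun_compose_linear norm_triangle_ineq\<close>)
      show "0 \<le> p P" for P
        unfolding p_def using bd by (rule limsup_norm_nonneg)
      show "p (z *\<^sub>C P) \<le> cmod z * p P" for z P
        unfolding p_def using bd
        by (rule limsup_norm_mult_le) (auto simp: cblinfun_compose_linear norm_scaleC)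
    qed
    show "complex_vector.subspace N"
      unfolding complex_vector.subspace_def N_def
      by (simp add: cblinfun_compose_linear)
    show "clinear (\<lambda>P. A o\<^sub>C\<^sub>L P)"
      by (simp add: clinear_def cblinfun_compose_linear)
    show "A o\<^sub>C\<^sub>L P \<in> N" if "P \<in> N" for P
    proof -
      have "A o\<^sub>C\<^sub>L (A o\<^sub>C\<^sub>L P) = A o\<^sub>C\<^sub>L (P o\<^sub>C\<^sub>L A)"
        using that by (simp add: N_def)
      also have "\<dots> = A o\<^sub>C\<^sub>L P o\<^sub>C\<^sub>L A"
        by (rule cblinfun_eqI) simp
      finally show ?thesis
        by (simp add: N_def)
    qed
    show "p (A o\<^sub>C\<^sub>L P) \<le> norm A * p P" for P
      unfolding p_def using bd
    proof (rule limsup_norm_mult_le)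
      have "norm (A o\<^sub>C\<^sub>L P o\<^sub>C\<^sub>L U n) \<le> norm A * norm (P o\<^sub>C\<^sub>L U n)" for n
      proof -
        have "A o\<^sub>C\<^sub>L P o\<^sub>C\<^sub>L U n = A o\<^sub>C\<^sub>L (P o\<^sub>C\<^sub>L U n)"
          by (rule cblinfun_eqI) simp
        then show ?thesis by (metis norm_cblinfun_compose)
      qed
      then show "eventually (\<lambda>n. norm (A o\<^sub>C\<^sub>L P o\<^sub>C\<^sub>L U n) \<le> norm A * norm (P o\<^sub>C\<^sub>L U n) + e) sequentially"
        if "e > 0" for e
        using that by (intro always_eventually allI) (meson add_increasing2 less_imp_le)
    qed simp
    show "\<exists>c>0. \<forall>P\<in>N. c * p P \<le> p (A o\<^sub>C\<^sub>L P - z *\<^sub>C P)" for z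
    proof -
      \<comment> \<open>The error term vanishes in the limit superior; including it lets both cases
        give one estimate. Only the case of \<open>B\<close> produces it.\<close>
      obtain c where c: "c > 0"
        "\<And>P n. P \<in> N \<Longrightarrow>
          c * norm (P o\<^sub>C\<^sub>L U n) \<le> norm ((A o\<^sub>C\<^sub>L P - z *\<^sub>C P) o\<^sub>C\<^sub>L U n) + norm P * norm (W n)"
        using disj[of z]
      proof
        assume "z \<notin> approx_spectrum A"
        then obtain c where c: "c > 0" "\<And>x. c * norm x \<le> norm ((A - z *\<^sub>C id_cblinfun) *\<^sub>V x)"
          by (auto simp: approx_spectrum_iff lower_bounded_def)
        have "c * norm (P o\<^sub>C\<^sub>L U n) \<le> norm ((A o\<^sub>C\<^sub>L P - z *\<^sub>C P) o\<^sub>C\<^sub>L U n)" for P n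
        proof -
          have "(A o\<^sub>C\<^sub>L P - z *\<^sub>C P) o\<^sub>C\<^sub>L U n = (A - z *\<^sub>C id_cblinfun) o\<^sub>C\<^sub>L (P o\<^sub>C\<^sub>L U n)"
            by (rule cblinfun_eqI) simp
          then show ?thesis
            using lower_bound_compose_left[OF c(2,1), of "P o\<^sub>C\<^sub>L U n"] by simp
        qed
        then show thesis
          using c(1) by (intro that) (auto intro: add_increasing2)
      next
        assume "z - l \<notin> approx_spectrum (banach_adjoint B)"
        then obtain c where c: "c > 0"
          "\<And>f. c * norm f \<le> norm (banach_adjoint (B - (z - l) *\<^sub>C id_cblinfun) *\<^sub>V f)"
          by (auto simp: approx_spectrum_iff banach_adjoint_shift lower_bounded_def)
        have "c * norm (P o\<^sub>C\<^sub>L U n) \<le> norm ((A o\<^sub>C\<^sub>L P - z *\<^sub>C P) o\<^sub>C\<^sub>L U n) + norm P * norm (W n)"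
          if "P \<in> N" for P n
        proof -
          have comm: "A o\<^sub>C\<^sub>L P = P o\<^sub>C\<^sub>L A"
            using that by (simp add: N_def)
          have AP: "A *\<^sub>V P *\<^sub>V x = P *\<^sub>V A *\<^sub>V x" for x
            using arg_cong[OF comm, of "\<lambda>F. F *\<^sub>V x"] by simp
          have "(A o\<^sub>C\<^sub>L P - z *\<^sub>C P) o\<^sub>C\<^sub>L U n = P o\<^sub>C\<^sub>L (A o\<^sub>C\<^sub>L U n - z *\<^sub>C U n)"
            by (rule cblinfun_eqI) (simp add: AP)
          then have "P o\<^sub>C\<^sub>L U n o\<^sub>C\<^sub>L (B - (z - l) *\<^sub>C id_cblinfun) =
              (A o\<^sub>C\<^sub>L P - z *\<^sub>C P) o\<^sub>C\<^sub>L U n - P o\<^sub>C\<^sub>L W n"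
            unfolding AU by (simp only:) (rule cblinfun_eqI, simp)
          then have "c * norm (P o\<^sub>C\<^sub>L U n) \<le> norm ((A o\<^sub>C\<^sub>L P - z *\<^sub>C P) o\<^sub>C\<^sub>L U n - P o\<^sub>C\<^sub>L W n)"
            using lower_bound_compose_right[OF c(2,1), of "P o\<^sub>C\<^sub>L U n"] by simp
          also have "\<dots> \<le> norm ((A o\<^sub>C\<^sub>L P - z *\<^sub>C P) o\<^sub>C\<^sub>L U n) + norm (P o\<^sub>C\<^sub>L W n)"
            by (rule norm_triangle_ineq4)
          also have "norm (P o\<^sub>C\<^sub>L W n) \<le> norm P * norm (W n)"
            by (rule norm_cblinfun_compose)
          finally show ?thesis by simp
        qed
        with c(1) show thesis by (rule that)
      qed
      have "c * p P \<le> p (A o\<^sub>C\<^sub>L P - z *\<^sub>C P)" if "P \<in> N" for P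
      proof -
        have "p P \<le> 1 / c * p (A o\<^sub>C\<^sub>L P - z *\<^sub>C P)"
          unfolding p_def using bd
        proof (rule limsup_norm_mult_le)
          fix e :: real assume "e > 0"
          have "(\<lambda>n. 1 / c * (norm P * norm (W n))) \<longlonglongrightarrow> 0"
            by (intro tendsto_mult_right_zero tendsto_norm_zero \<open>W \<longlonglongrightarrow> 0\<close>)
          then have "eventually (\<lambda>n. 1 / c * (norm P * norm (W n)) < e) sequentially"
            using \<open>e > 0\<close> by (rule order_tendstoD)
          then show "eventually (\<lambda>n. norm (P o\<^sub>C\<^sub>L U n) \<le>
              1 / c * norm ((A o\<^sub>C\<^sub>L P - z *\<^sub>C P) o\<^sub>C\<^sub>L U n) + e) sequentially"
          proof eventually_elim
            case (elim n)
            have "norm (P o\<^sub>C\<^sub>L U n) = 1 / c * (c * norm (P o\<^sub>C\<^sub>L U n))"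
              using c(1) by simp
            also have "\<dots> \<le> 1 / c * (norm ((A o\<^sub>C\<^sub>L P - z *\<^sub>C P) o\<^sub>C\<^sub>L U n) + norm P * norm (W n))"
              using c(1) c(2)[OF that, of n] by (intro mult_left_mono) auto
            finally show ?case
              using elim unfolding distrib_left by linarith
          qed
        qed (use c(1) in simp)
        then show ?thesis
          using c(1) by (simp add: field_simps)
      qed
      with c(1) show ?thesis by blast
    qed
    show "id_cblinfun \<in> N"
      unfolding N_def by (simp add: cblinfun_eqI)
  qed simp
  \<comment> \<open>The normalisation of the \<open>U n\<close> contradicts the vanishing of the
    seminorm at the identity.\<close>
  moreover have "1 \<le> p id_cblinfun"
    unfolding p_def using bd
  proof (rule limsup_norm_ge)
    have "id_cblinfun o\<^sub>C\<^sub>L U n = U n" for n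
      by (rule cblinfun_eqI) simp
    then show "1 \<le> t" if "eventually (\<lambda>n. norm (id_cblinfun o\<^sub>C\<^sub>L U n) \<le> t) sequentially" for t
      using that by (simp add: U1)
  qed
  ultimately show False by simp
qed

section \<open>Isoloid operators\<close>

lemma nullity_pos_iff: "0 < nullity T \<longleftrightarrow> (\<exists>x. x \<noteq> 0 \<and> T *\<^sub>V x = 0)"
proof (cases "finite_dimensional (null_space T)")
  case True
  then obtain F where F: "finite F" "null_space T \<subseteq> complex_vector.span F"
    by (auto simp: finite_dimensional_def)
  obtain B where B: "B \<subseteq> null_space T" "complex_vector.independent B"
      "null_space T \<subseteq> complex_vector.span B" "card B = complex_vector.dim (null_space T)"
    using complex_vector.basis_exists by blast
  have "finite B"
    using complex_vector.independent_span_bound[OF F(1) B(2)] B(1) F(2) by blast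
  have "0 \<notin> B"
    using B(2) complex_vector.dependent_zero by blast
  have "complex_vector.dim (null_space T) = 0 \<longleftrightarrow> null_space T \<subseteq> {0}"
    using B \<open>finite B\<close> \<open>0 \<notin> B\<close> by (metis card_0_eq complex_vector.span_empty subset_empty subset_singletonD
        insert_subset subsetI singletonD)
  with True show ?thesis
    by (auto simp: nullity_def cdimension_def null_space_def zero_enat_def)
next
  case False
  have "\<not> null_space T \<subseteq> complex_vector.span {}"
    using False unfolding finite_dimensional_def by blast
  with False show ?thesis
    by (auto simp: nullity_def cdimension_def null_space_def)
qed

text \<open>One inclusion holds by definition, so only the existence of eigenvectors at isolated
  points is at stake.\<close>

lemma isoloid_iff:
  "isoloid T \<longleftrightarrow> (\<forall>z\<in>iso (spectrum T). \<exists>x. x \<noteq> 0 \<and> T *\<^sub>V x = z *\<^sub>C x)"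
  unfolding isoloid_def isolated_eigenvalues_def nullity_pos_iff by auto

lemma a_isoloid_iff:
  "a_isoloid T \<longleftrightarrow> (\<forall>z\<in>iso (approx_spectrum T). \<exists>x. x \<noteq> 0 \<and> T *\<^sub>V x = z *\<^sub>C x)"
  unfolding a_isoloid_def a_isolated_eigenvalues_def nullity_pos_iff by auto

lemma iso_difference:
  assumes "a - b \<in> iso S" "a \<in> P" "b \<in> Q" and sub: "\<And>a b. a \<in> P \<Longrightarrow> b \<in> Q \<Longrightarrow> a - b \<in> S"
  shows "a \<in> iso P" "b \<in> iso Q"
proof -
  obtain e where e: "e > 0" "\<And>y. y \<in> S \<Longrightarrow> dist (a - b) y < e \<Longrightarrow> y = a - b"
    using assms(1) by (auto simp: iso_def isolated_in_dist_Ex_iff)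
  have "y = a" if "y \<in> P" "dist a y < e" for y
    using e(2)[OF sub[OF that(1) assms(3)]] that(2) by (simp add: dist_norm)
  moreover have "y = b" if "y \<in> Q" "dist b y < e" for y
    using e(2)[OF sub[OF assms(2) that(1)]] that(2) by (simp add: dist_norm norm_minus_commute)
  ultimately show "a \<in> iso P" "b \<in> iso Q"
    using assms(2,3) e(1) unfolding iso_def isolated_in_dist_Ex_iff by blast+
qed

lemma iso_spectrum_subset: "iso (spectrum T) \<subseteq> approx_spectrum T"
proof
  fix z assume "z \<in> iso (spectrum T)"
  then obtain e where z: "z \<in> spectrum T" and e: "e > 0" "\<And>y. y \<in> spectrum T \<Longrightarrow> dist z y < e \<Longrightarrow> y = z"
    by (auto simp: iso_def isolated_in_dist_Ex_iff)
  have "z \<in> closure (- spectrum T)"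
    unfolding closure_approachable
  proof (intro allI impI)
    fix d :: real assume "d > 0"
    define s where "s = min d e / 2"
    have s: "0 < s" "s < d" "s < e" using \<open>d > 0\<close> e(1) by (auto simp: s_def)
    then have "z + of_real s \<notin> spectrum T"
      using e(2)[of "z + of_real s"] by (auto simp: dist_norm)
    with s show "\<exists>y\<in>- spectrum T. dist y z < d"
      by (intro bexI[of _ "z + of_real s"]) (auto simp: dist_norm)
  qed
  with z show "z \<in> approx_spectrum T"
    by (rule boundary_spectrum)
qed

lemma derivation_eigenvector:
  fixes A :: "'x::complex_banach \<Rightarrow>\<^sub>C\<^sub>L 'x" and B :: "'y::complex_banach \<Rightarrow>\<^sub>C\<^sub>L 'y"
  assumes "x \<noteq> 0" "A *\<^sub>V x = a *\<^sub>C x" "f \<noteq> 0" "banach_adjoint B *\<^sub>V f = b *\<^sub>C f"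
  shows "\<exists>U. U \<noteq> 0 \<and> generalized_derivation A B *\<^sub>V U = (a - b) *\<^sub>C U"
proof (intro exI conjI)
  show "rank_one x f \<noteq> 0"
    using norm_rank_one[of x f] assms(1,3) by auto
  have "rank_one (0 :: 'x) f = 0" "rank_one x (0 :: 'y dual) = 0"
    using norm_rank_one[of 0 f] norm_rank_one[of x 0] by auto
  then have "(generalized_derivation A B - (a - b) *\<^sub>C id_cblinfun) *\<^sub>V rank_one x f = 0"
    unfolding derivation_rank_one using assms(2,4) by simp
  then show "generalized_derivation A B *\<^sub>V rank_one x f = (a - b) *\<^sub>C rank_one x f"
    by simp
qed

theorem proposition5p1:
  fixes A :: "'x::complex_banach \<Rightarrow>\<^sub>C\<^sub>L 'x"
    and B :: "'y::complex_banach \<Rightarrow>\<^sub>C\<^sub>L 'y"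
  assumes "\<not> finite_dimensional (UNIV :: 'x set)"
    and "\<not> finite_dimensional (UNIV :: 'y set)"
  shows "(isoloid A \<and> isoloid (banach_adjoint B) \<longrightarrow> isoloid (generalized_derivation A B)) \<and>
    (a_isoloid A \<and> a_isoloid (banach_adjoint B) \<longrightarrow> a_isoloid (generalized_derivation A B))"
proof (intro conjI impI)
  assume iso: "isoloid A \<and> isoloid (banach_adjoint B)"
  show "isoloid (generalized_derivation A B)"
    unfolding isoloid_iff
  proof
    fix l assume l: "l \<in> iso (spectrum (generalized_derivation A B))"
    then obtain a b where ab: "a \<in> approx_spectrum A" "b \<in> approx_spectrum (banach_adjoint B)" "l = a - b"
      using iso_spectrum_subset approx_spectrum_derivation_subset by (metis subsetD)
    \<comment> \<open>The hypotheses speak of isolation in the full spectra, so \<open>a\<close> and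
      \<open>b\<close> are now regarded as points of these.\<close>
    then have "a \<in> spectrum A" "b \<in> spectrum (banach_adjoint B)"
      using approx_spectrum_subset_spectrum by blast+
    then have "a \<in> iso (spectrum A)" "b \<in> iso (spectrum (banach_adjoint B))"
      using iso_difference[OF l[unfolded ab(3)]] spectrum_derivation_superset
      unfolding spectrum_adjoint by metis+
    with iso ab(3) show "\<exists>U. U \<noteq> 0 \<and> generalized_derivation A B *\<^sub>V U = l *\<^sub>C U"
      unfolding isoloid_iff by (metis derivation_eigenvector)
  qed
next
  assume iso: "a_isoloid A \<and> a_isoloid (banach_adjoint B)"
  show "a_isoloid (generalized_derivation A B)"
    unfolding a_isoloid_iff
  proof
    fix l assume l: "l \<in> iso (approx_spectrum (generalized_derivation A B))"
    then have "l \<in> approx_spectrum (generalized_derivation A B)"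
      by (simp add: iso_def isolated_in_def)
    then obtain a b where ab: "a \<in> approx_spectrum A" "b \<in> approx_spectrum (banach_adjoint B)" "l = a - b"
      using approx_spectrum_derivation_subset by metis
    \<comment> \<open>Here the inclusion between approximate point spectra suffices to transfer
      isolation.\<close>
    then have "a \<in> iso (approx_spectrum A)" "b \<in> iso (approx_spectrum (banach_adjoint B))"
      using iso_difference[OF l[unfolded ab(3)]] approx_spectrum_derivation_superset by metis+
    with iso ab(3) show "\<exists>U. U \<noteq> 0 \<and> generalized_derivation A B *\<^sub>V U = l *\<^sub>C U"
      unfolding a_isoloid_iff by (metis derivation_eigenvector)
  qed
qed

end
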